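(* Let $k\ge2$ be an integer and let $X_1,\dots,X_n$ be an i.i.d. sample from a $k$-monotone density on $(0,\infty)$. For a nonnegative measure $\mu$ on $(0,\infty)$ let $$\Phi_n(\mu)=\frac12\int_0^\infty\!\!\int_0^\infty r_k(t,t')\,d\mu(t)\,d\mu(t')-\int_0^\infty s_{n,k}(t)\,d\mu(t),$$ where $r_k(t,t')=\int_0^{t\wedge t'}(t-x)^{k-1}(t'-x)^{k-1}dx$ and $s_{n,k}(t)=\frac1n\sum_{i=1}^n(t-X_i)_+^{k-1}$. Then the problem of minimizing $\Phi_n(\mu)$ over all nonnegative measures $\mu$ has a unique solution $\tilde\mu$.
   Context: For $k\ge2$, a function $g$ on $(0,\infty)$ is $k$-monotone if $(-1)^l g^{(l)}$ is nonnegative, nonincreasing and convex for $l=0,\dots,k-2$. Notation $y_+=\max(y,0)$. The problem is the reformulation of the minimization of the least squares criterion $Q_n(g)=\frac12\int_0^\infty g^2(x)dx-\frac1n\sum_{i=1}^n g(X_i)$ over square-integrable $k$-monotone functions $g$, written as $g=g_\mu$ with $g_\mu(x)=\int_0^\infty(t-x)_+^{k-1}d\mu(t)$; then $\int_0^\infty g_\mu^2(x)\,dx=\iint r_k\,d\mu\,d\mu$ and $\Phi_n(\mu)=Q_n(g_\mu)$. Accordingly, the measures $\mu$ considered are those for which $\iint r_k\,d\mu\,d\mu<\infty$ (i.e. $g_\mu$ is square integrable). *)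

theory Defs
  imports "HOL-Probability.Probability"
begin

text \<open>Only the values of \<open>g\<close> on \<open>(0, \<infinity>)\<close> matter: the half-line is open and
  \<^const>\<open>deriv\<close> is local. \<^const>\<open>deriv\<close> is total, so the existence of the derivatives up to
  order \<open>k - 2\<close> is required separately.\<close>

definition k_monotone :: "nat \<Rightarrow> (real \<Rightarrow> real) \<Rightarrow> bool" where
  "k_monotone k g \<longleftrightarrow>
     (\<forall>l<k - 2. \<forall>x>0. ((deriv ^^ l) g) field_differentiable (at x)) \<and>
     (\<forall>l\<le>k - 2.
        (\<forall>x>0. 0 \<le> (-1) ^ l * (deriv ^^ l) g x) \<and>
        antimono_on {0<..} (\<lambda>x. (-1) ^ l * (deriv ^^ l) g x) \<and>
        convex_on {0<..} (\<lambda>x. (-1) ^ l * (deriv ^^ l) g x))"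

definition r_kernel :: "nat \<Rightarrow> real \<Rightarrow> real \<Rightarrow> real" where
  "r_kernel k t t' = (LBINT x:{0..min t t'}. (t - x) ^ (k - 1) * (t' - x) ^ (k - 1))"

definition s_emp :: "nat \<Rightarrow> nat \<Rightarrow> (nat \<Rightarrow> real) \<Rightarrow> real \<Rightarrow> real" where
  "s_emp n k x t = (1 / real n) * (\<Sum>i=1..n. (max (t - x i) 0) ^ (k - 1))"

text \<open>The Borel measures \<open>\<mu>\<close> on \<open>(0, \<infinity>)\<close> with \<open>\<integral>\<integral> r\<^sub>k d\<mu> d\<mu> < \<infinity>\<close>, that is, with \<open>x \<mapsto> \<integral> (t - x)\<^sub>+\<^sup>k\<^sup>-\<^sup>1 d\<mu>(t)\<close>
  square integrable on \<open>(0, \<infinity>)\<close>. They need not be finite: mass may accumulate at \<open>0\<close>.\<close>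

definition mixing_measures :: "nat \<Rightarrow> real measure set" where
  "mixing_measures k =
     {\<mu>. sets \<mu> = sets (restrict_space borel {0<..}) \<and>
         (\<integral>\<^sup>+ t'. (\<integral>\<^sup>+ t. ennreal (r_kernel k t t') \<partial>\<mu>) \<partial>\<mu>) < \<infinity>}"

text \<open>For \<open>\<mu>\<close> in \<^const>\<open>mixing_measures\<close> and a sample in \<open>(0, \<infinity>)\<close> all integrals below are
  finite, so the value 0 that the Bochner integral assigns to non-integrable functions plays
  no role.\<close>

definition ls_criterion :: "nat \<Rightarrow> nat \<Rightarrow> (nat \<Rightarrow> real) \<Rightarrow> real measure \<Rightarrow> real" where
  "ls_criterion n k x \<mu> =
     1 / 2 * (\<integral>t'. (\<integral>t. r_kernel k t t' \<partial>\<mu>) \<partial>\<mu>) - (\<integral>t. s_emp n k x t \<partial>\<mu>)"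

end

theory Submission
  imports Defs
begin

text \<open>
  Put \<open>j = k - 1\<close> and \<open>g\<^sub>\<mu>(x) = \<integral>(t - x)\<^sub>+\<^sup>j d\<mu>(t)\<close>. Every sample point is positive on the whole space, so the
  sample can be fixed once and for all and the statement is a deterministic one. By Tonelli the
  quadratic term is \<open>\<integral>g\<^sub>\<mu>\<^sup>2\<close> over the positive half-line, called the energy below
  (\<open>energy_eq_double_integral\<close>), and the linear term is the average of the values \<open>g\<^sub>\<mu>(X\<^sub>i)\<close>
  (\<open>ls_criterion_eq\<close>). Since \<open>g\<^sub>\<mu>\<close> is nonincreasing, \<open>x g\<^sub>\<mu>(x)\<^sup>2\<close> is at most the energy; hence the criterion
  is bounded below and controls the energy (\<open>ls_criterion_ge\<close>).

  Existence is the direct method. The energies of a minimizing sequence are bounded. The mixing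
  measures themselves may have infinite mass near \<open>0\<close>, but with the weight
  \<open>t\<^sup>j\<^sup>+\<^sup>1 / (1 + t)\<close>, which is comparable to \<open>\<integral>(t - x)\<^sub>+\<^sup>j dx\<close> over \<open>0 < x \<le> 1\<close>, they become finite
  measures of bounded mass. Completed by an atom at \<open>0\<close> they are a tight sequence of probability
  measures, and Helly's theorem gives a weak limit (\<open>mixture_compactness\<close>). The functions
  \<open>(t - x)\<^sub>+\<^sup>j\<close> divided by the weight are bounded, continuous and vanish near \<open>0\<close>, so the mixtures
  converge at every \<open>x > 0\<close> and an atom of the limit at \<open>0\<close> is invisible. The linear term thus converges,
  and Fatou's lemma bounds the energy of the limit (\<open>ls_minimizer_exists\<close>).

  Uniqueness is the parallelogram identity: the midpoint of two minimizers \<open>\<mu>\<close> and \<open>\<nu>\<close> would do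
  better by \<open>1/8\<close> of \<open>\<integral>(g\<^sub>\<mu> - g\<^sub>\<nu>)\<^sup>2\<close>, so the two mixtures agree almost everywhere and, being
  right-continuous, everywhere. A mixture determines its mixing measure
  (\<open>mixture_determines_measure\<close>): taking the right derivative lowers the exponent by one, and after
  \<open>j\<close> steps the tails \<open>\<mu>(x, \<infinity>)\<close> are recovered.
\<close>

section \<open>Sums of measures\<close>

definition plus_measure :: "'a measure \<Rightarrow> 'a measure \<Rightarrow> 'a measure" where
  "plus_measure M N = measure_of (space M) (sets M) (\<lambda>A. emeasure M A + emeasure N A)"

lemma sets_plus_measure [simp, measurable_cong]: "sets (plus_measure M N) = sets M"
  and space_plus_measure [simp]: "space (plus_measure M N) = space M"
  by (simp_all add: plus_measure_def)

lemma emeasure_plus_measure: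
  assumes "sets N = sets M" and A: "A \<in> sets M"
  shows "emeasure (plus_measure M N) A = emeasure M A + emeasure N A"
  unfolding plus_measure_def
proof (rule emeasure_measure_of_sigma)
  show "sigma_algebra (space M) (sets M)"
    by (rule sets.sigma_algebra_axioms)
  show "positive (sets M) (\<lambda>A. emeasure M A + emeasure N A)"
    by (auto simp: positive_def)
  show "countably_additive (sets M) (\<lambda>A. emeasure M A + emeasure N A)"
  proof (rule countably_additiveI)
    fix F :: "nat \<Rightarrow> 'a set"
    assume F: "range F \<subseteq> sets M" "disjoint_family F"
    then have "(\<Sum>i. emeasure M (F i)) = emeasure M (\<Union>i. F i)"
      and "(\<Sum>i. emeasure N (F i)) = emeasure N (\<Union>i. F i)"
      using assms(1) by (auto intro!: suminf_emeasure)
    then show "(\<Sum>i. emeasure M (F i) + emeasure N (F i)) = emeasure M (\<Union>i. F i) + emeasure N (\<Union>i. F i)"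
      by (simp add: suminf_add[symmetric] summableI)
  qed
qed fact

lemma nn_integral_plus_measure:
  assumes sets: "sets N = sets M" and f: "f \<in> borel_measurable M"
  shows "(\<integral>\<^sup>+x. f x \<partial>plus_measure M N) = (\<integral>\<^sup>+x. f x \<partial>M) + (\<integral>\<^sup>+x. f x \<partial>N)"
proof -
  note [measurable_cong] = sets
  have sp: "space N = space M"
    using sets by (rule sets_eq_imp_space_eq)
  show ?thesis
    using f
  proof induct
    case (cong f g)
    have eq: "nn_integral P f = nn_integral P g" if "space P = space M" for P
      using cong(3) that by (intro nn_integral_cong) simp
    show ?case
      using cong(4) by (simp only: eq[OF refl] eq[OF sp] eq[OF space_plus_measure])
  next
    case (set A)
    then show ?case
      using sets by (simp add: emeasure_plus_measure)
  next
    case (mult u c)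
    then have "u \<in> borel_measurable N" by simp
    with mult show ?case
      by (simp add: nn_integral_cmult distrib_left)
  next
    case (add u v)
    then have "u \<in> borel_measurable N" "v \<in> borel_measurable N" by simp_all
    with add show ?case
      by (simp add: nn_integral_add ac_simps)
  next
    case (seq U)
    have U: "U i \<in> borel_measurable N" for i
      using seq by simp
    have inc: "incseq (\<lambda>i. nn_integral P (U i))" for P
      using \<open>incseq U\<close> by (auto simp: incseq_def le_fun_def intro!: nn_integral_mono)
    show ?case
      using seq U inc
      by (simp add: nn_integral_monotone_convergence_SUP image_comp ennreal_SUP_add)
  qed
qed

section \<open>Scale mixtures of truncated powers\<close>

text \<open>The case distinction, rather than \<open>max (t - x) 0 ^ j\<close>, makes the exponent \<open>0\<close> give the indicator
  of \<open>{x<..}\<close>. This is the end of the descent in the exponent that recovers a measure from its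
  mixture.\<close>

definition trunc_pow :: "nat \<Rightarrow> real \<Rightarrow> real \<Rightarrow> real" where
  "trunc_pow j x t = (if x < t then (t - x) ^ j else 0)"

definition mixture :: "nat \<Rightarrow> real measure \<Rightarrow> real \<Rightarrow> ennreal" where
  "mixture j \<mu> x = (\<integral>\<^sup>+t. ennreal (trunc_pow j x t) \<partial>\<mu>)"

definition energy :: "nat \<Rightarrow> real measure \<Rightarrow> ennreal" where
  "energy j \<mu> = (\<integral>\<^sup>+x\<in>{0<..}. (mixture j \<mu> x)\<^sup>2 \<partial>lborel)"

text \<open>Finite mass away from \<open>0\<close> is what finite energy implies; it makes Tonelli's theorem available and
  lets tails determine the measure. Mass near \<open>0\<close> may be infinite.\<close>

definition halfline_measure :: "real measure \<Rightarrow> bool" where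
  "halfline_measure \<mu> \<longleftrightarrow>
     sets \<mu> = sets (restrict_space borel {0<..}) \<and> (\<forall>a>0. emeasure \<mu> {a..} < \<infinity>)"

lemma trunc_pow_nonneg [simp]: "0 \<le> trunc_pow j x t"
  by (simp add: trunc_pow_def)

lemma trunc_pow_eq_max: "0 < j \<Longrightarrow> trunc_pow j x t = max (t - x) 0 ^ j"
  by (simp add: trunc_pow_def max_def)

lemma trunc_pow_antimono: "x \<le> y \<Longrightarrow> trunc_pow j y t \<le> trunc_pow j x t"
  by (auto simp: trunc_pow_def intro!: power_mono)

lemma trunc_pow_measurable [measurable]:
  assumes [measurable]: "f \<in> borel_measurable M" "g \<in> borel_measurable M"
  shows "(\<lambda>z. trunc_pow j (f z) (g z)) \<in> borel_measurable M"
  unfolding trunc_pow_def by measurable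

lemma mixture_antimono: "x \<le> y \<Longrightarrow> mixture j \<mu> y \<le> mixture j \<mu> x"
  unfolding mixture_def by (intro nn_integral_mono ennreal_leI trunc_pow_antimono)

lemma measurable_on_halfline:
  assumes "sets \<mu> = sets (restrict_space borel {0<..})" and "f \<in> borel_measurable borel"
  shows "f \<in> borel_measurable (\<mu> :: real measure)"
  using assms(2) measurable_cong_sets[OF assms(1) refl] measurable_restrict_space1 by blast

lemma
  assumes "halfline_measure \<mu>"
  shows space_halfline: "space \<mu> = {0<..}"
    and sets_halfline: "sets \<mu> = sets (restrict_space borel {0<..})"
    and atLeast_in_halfline: "0 < a \<Longrightarrow> {a..} \<in> sets \<mu>"
    and emeasure_halfline_finite: "0 < a \<Longrightarrow> emeasure \<mu> {a..} < \<infinity>"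
proof -
  show s: "sets \<mu> = sets (restrict_space borel {0<..})"
    using assms by (simp add: halfline_measure_def)
  show "space \<mu> = {0<..}"
    using sets_eq_imp_space_eq[OF s] by (simp add: space_restrict_space)
  show "{a..} \<in> sets \<mu>" if "0 < a"
    unfolding s sets_restrict_space using that by (auto intro!: image_eqI[of _ _ "{a..}"])
  show "emeasure \<mu> {a..} < \<infinity>" if "0 < a"
    using assms that by (simp add: halfline_measure_def)
qed

lemma sigma_finite_halfline:
  assumes "halfline_measure \<mu>"
  shows "sigma_finite_measure \<mu>"
proof
  let ?A = "range (\<lambda>n. {1 / real (Suc n)..})"
  have "\<exists>n. 1 / real (Suc n) \<le> x" if "0 < x" for x
    using that by (metis inverse_eq_divide less_imp_le reals_Archimedean)
  then have "\<Union>?A = space \<mu>"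
    unfolding space_halfline[OF assms] by (force intro: less_le_trans[rotated])
  moreover have "?A \<subseteq> sets \<mu>"
    using atLeast_in_halfline[OF assms] by auto
  moreover have "\<forall>a\<in>?A. emeasure \<mu> a \<noteq> \<infinity>"
    using emeasure_halfline_finite[OF assms] by (auto simp: less_top)
  ultimately show "\<exists>A. countable A \<and> A \<subseteq> sets \<mu> \<and> \<Union> A = space \<mu> \<and> (\<forall>a\<in>A. emeasure \<mu> a \<noteq> \<infinity>)"
    by (intro exI[of _ ?A]) auto
qed

lemma ennreal_r_kernel:
  assumes k: "k \<ge> 2"
  shows "ennreal (r_kernel k t t') =
    (\<integral>\<^sup>+x. indicator {0<..} x * (ennreal (trunc_pow (k - 1) x t) * ennreal (trunc_pow (k - 1) x t')) \<partial>lborel)"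
proof -
  let ?j = "k - 1"
  let ?f = "\<lambda>x. (t - x) ^ ?j * (t' - x) ^ ?j"
  have int: "integrable lborel (\<lambda>x. indicator {0..min t t'} x *\<^sub>R ?f x)"
    by (intro borel_integrable_compact continuous_intros) auto
  have "ennreal (r_kernel k t t') = (\<integral>\<^sup>+x. ennreal (indicator {0..min t t'} x *\<^sub>R ?f x) \<partial>lborel)"
    unfolding r_kernel_def set_lebesgue_integral_def
    by (rule nn_integral_eq_integral[OF int, symmetric]) (auto split: split_indicator)
  also have "\<dots> = (\<integral>\<^sup>+x. indicator {0<..} x * (ennreal (trunc_pow ?j x t) * ennreal (trunc_pow ?j x t')) \<partial>lborel)"
  proof (rule nn_integral_cong_AE)
    have "AE x in lborel. x \<noteq> (0::real)"
      by (rule AE_lborel_singleton)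
    then show "AE x in lborel. ennreal (indicator {0..min t t'} x *\<^sub>R ?f x) =
        indicator {0<..} x * (ennreal (trunc_pow ?j x t) * ennreal (trunc_pow ?j x t'))"
    proof eventually_elim
      case (elim x)
      show ?case
      proof (cases "0 < x \<and> x < t \<and> x < t'")
        case True
        then show ?thesis
          by (simp add: trunc_pow_def ennreal_mult)
      next
        case False
        then have "0 < x \<Longrightarrow> trunc_pow ?j x t = 0 \<or> trunc_pow ?j x t' = 0"
          by (auto simp: trunc_pow_def)
        moreover have "0 \<le> x \<Longrightarrow> x \<le> min t t' \<Longrightarrow> ?f x = 0"
          using False elim k by auto
        ultimately show ?thesis
          using elim by (auto split: split_indicator)
      qed
    qed
  qed
  finally show ?thesis .
qed

text \<open>A positive constant bounds the kernel from below on \<open>{a..} \<times> {a..}\<close>, so finite energy forces finite mass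
  away from \<open>0\<close>.\<close>

lemma mixing_imp_halfline:
  assumes k: "k \<ge> 2" and \<mu>: "\<mu> \<in> mixing_measures k"
  shows "halfline_measure \<mu>"
proof -
  have s: "sets \<mu> = sets (restrict_space borel {0<..})"
    and fin: "(\<integral>\<^sup>+ t'. (\<integral>\<^sup>+ t. ennreal (r_kernel k t t') \<partial>\<mu>) \<partial>\<mu>) < \<infinity>"
    using \<mu> by (auto simp: mixing_measures_def)
  have "emeasure \<mu> {a..} < \<infinity>" if a: "0 < a" for a
  proof -
    have A: "{a..} \<in> sets \<mu>"
      unfolding s sets_restrict_space using a by (auto intro!: image_eqI[of _ _ "{a..}"])
    define d where "d = (a / 2) ^ (k - 1)"
    have d: "0 < d" using a by (simp add: d_def)
    define c where "c = ennreal (d * d) * ennreal (a / 2)"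
    have c: "c \<noteq> 0" using a d by (simp add: c_def)
    have r: "c * indicator {a..} t' * indicator {a..} t \<le> ennreal (r_kernel k t t')" for t t'
    proof (cases "a \<le> t \<and> a \<le> t'")
      case True
      have below: "d \<le> trunc_pow (k - 1) x s" if "x \<le> a / 2" "a \<le> s" for x s
        using that a by (auto simp: d_def trunc_pow_def intro!: power_mono)
      have "c = (\<integral>\<^sup>+x. ennreal (d * d) * indicator {0<..a/2} x \<partial>lborel)"
        unfolding c_def using a by (subst nn_integral_cmult_indicator) simp_all
      also have "\<dots> \<le> ennreal (r_kernel k t t')"
        unfolding ennreal_r_kernel[OF k]
      proof (rule nn_integral_mono)
        fix x
        have "ennreal (d * d) \<le> ennreal (trunc_pow (k - 1) x t) * ennreal (trunc_pow (k - 1) x t')"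
          if "x \<le> a / 2"
          unfolding ennreal_mult[OF trunc_pow_nonneg trunc_pow_nonneg, symmetric]
          using that True d below[of x t] below[of x t'] by (intro ennreal_leI mult_mono) auto
        then show "ennreal (d * d) * indicator {0<..a/2} x \<le> indicator {0<..} x *
            (ennreal (trunc_pow (k - 1) x t) * ennreal (trunc_pow (k - 1) x t'))"
          by (auto split: split_indicator)
      qed
      finally show ?thesis using True by simp
    qed (auto split: split_indicator)
    have "c * emeasure \<mu> {a..} * emeasure \<mu> {a..} =
        (\<integral>\<^sup>+ t'. (c * emeasure \<mu> {a..}) * indicator {a..} t' \<partial>\<mu>)"
      by (rule nn_integral_cmult_indicator[OF A, symmetric])
    also have "\<dots> = (\<integral>\<^sup>+ t'. (\<integral>\<^sup>+ t. c * indicator {a..} t' * indicator {a..} t \<partial>\<mu>) \<partial>\<mu>)"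
      by (intro nn_integral_cong) (subst nn_integral_cmult_indicator[OF A], simp add: ac_simps)
    also have "\<dots> \<le> (\<integral>\<^sup>+ t'. (\<integral>\<^sup>+ t. ennreal (r_kernel k t t') \<partial>\<mu>) \<partial>\<mu>)"
      by (intro nn_integral_mono r)
    finally have "c * emeasure \<mu> {a..} * emeasure \<mu> {a..} < \<infinity>"
      using fin by (rule le_less_trans)
    then show ?thesis
      using c by (cases "emeasure \<mu> {a..}") (auto simp: ennreal_mult_top ennreal_top_mult)
  qed
  with s show ?thesis by (simp add: halfline_measure_def)
qed

lemma mixture_measurable:
  assumes "halfline_measure \<mu>"
  shows "mixture j \<mu> \<in> borel_measurable borel"
proof -
  interpret sigma_finite_measure \<mu> by (rule sigma_finite_halfline) fact
  have [measurable]: "(\<lambda>t. t) \<in> borel_measurable \<mu>"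
    by (rule measurable_on_halfline) (auto simp: sets_halfline[OF assms])
  show ?thesis unfolding mixture_def by measurable
qed

text \<open>The kernel is itself an integral over \<open>x\<close> of a product of truncated powers, so integrating first in
  \<open>t\<close> and \<open>t'\<close> produces the square of the mixture.\<close>

lemma energy_eq_double_integral:
  assumes k: "k \<ge> 2" and \<mu>: "halfline_measure \<mu>"
  shows "(\<integral>\<^sup>+ t'. (\<integral>\<^sup>+ t. ennreal (r_kernel k t t') \<partial>\<mu>) \<partial>\<mu>) = energy (k - 1) \<mu>"
proof -
  let ?j = "k - 1"
  interpret S: sigma_finite_measure \<mu> by (rule sigma_finite_halfline) fact
  interpret P: pair_sigma_finite lborel \<mu> by unfold_locales
  have [measurable]: "(\<lambda>t. t) \<in> borel_measurable \<mu>"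
    by (rule measurable_on_halfline) (auto simp: sets_halfline[OF \<mu>])
  note [measurable] = mixture_measurable[OF \<mu>, of ?j]
  have "(\<integral>\<^sup>+ t. ennreal (r_kernel k t t') \<partial>\<mu>) =
      (\<integral>\<^sup>+x. indicator {0<..} x * (mixture ?j \<mu> x * ennreal (trunc_pow ?j x t')) \<partial>lborel)" for t'
    unfolding ennreal_r_kernel[OF k]
    by (subst P.Fubini') (simp_all add: nn_integral_cmult nn_integral_multc mixture_def)
  then have "(\<integral>\<^sup>+ t'. (\<integral>\<^sup>+ t. ennreal (r_kernel k t t') \<partial>\<mu>) \<partial>\<mu>) =
      (\<integral>\<^sup>+ t'. (\<integral>\<^sup>+x. indicator {0<..} x * (mixture ?j \<mu> x * ennreal (trunc_pow ?j x t')) \<partial>lborel) \<partial>\<mu>)"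
    by simp
  also have "\<dots> = (\<integral>\<^sup>+x. indicator {0<..} x * (mixture ?j \<mu> x * mixture ?j \<mu> x) \<partial>lborel)"
    by (subst P.Fubini') (simp_all add: nn_integral_cmult mixture_def)
  also have "\<dots> = energy ?j \<mu>"
    by (simp add: energy_def power2_eq_square mult.commute)
  finally show ?thesis .
qed

lemma mixing_measures_iff:
  assumes "k \<ge> 2"
  shows "\<mu> \<in> mixing_measures k \<longleftrightarrow> halfline_measure \<mu> \<and> energy (k - 1) \<mu> < \<infinity>"
proof
  assume \<mu>: "\<mu> \<in> mixing_measures k"
  note h = mixing_imp_halfline[OF assms \<mu>]
  then show "halfline_measure \<mu> \<and> energy (k - 1) \<mu> < \<infinity>"
    using \<mu> energy_eq_double_integral[OF assms h] by (simp add: mixing_measures_def)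
next
  assume "halfline_measure \<mu> \<and> energy (k - 1) \<mu> < \<infinity>"
  then show "\<mu> \<in> mixing_measures k"
    using energy_eq_double_integral[OF assms, of \<mu>] by (simp add: mixing_measures_def sets_halfline)
qed

text \<open>A mixture is nonincreasing, so it is at least its value at \<open>a\<close> on all of \<open>{0<..a}\<close>. This is how
  the energy controls point evaluations.\<close>

lemma mixture_square_le_energy:
  assumes "0 < a"
  shows "ennreal a * (mixture j \<mu> a)\<^sup>2 \<le> energy j \<mu>"
proof -
  have "ennreal a * (mixture j \<mu> a)\<^sup>2 = (\<integral>\<^sup>+x. (mixture j \<mu> a)\<^sup>2 * indicator {0<..a} x \<partial>lborel)"
    using assms by (subst nn_integral_cmult_indicator) (simp_all add: mult.commute)
  also have "\<dots> \<le> energy j \<mu>"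
    unfolding energy_def
    by (intro nn_integral_mono) (auto split: split_indicator intro!: power_mono mixture_antimono)
  finally show ?thesis .
qed

lemma mixture_finite:
  assumes "energy j \<mu> < \<infinity>" and "0 < a"
  shows "mixture j \<mu> a < \<infinity>"
proof -
  have "ennreal a * (mixture j \<mu> a)\<^sup>2 < \<infinity>"
    using mixture_square_le_energy[OF assms(2)] assms(1) by (rule le_less_trans)
  then show ?thesis
    using assms(2) by (cases "mixture j \<mu> a") (auto simp: power2_eq_square ennreal_mult_top ennreal_top_mult)
qed

lemma mixture_le_sqrt_energy:
  assumes "energy j \<mu> < \<infinity>" and "0 < a"
  shows "enn2real (mixture j \<mu> a) \<le> sqrt (enn2real (energy j \<mu>) / a)"
proof -
  obtain g where g: "mixture j \<mu> a = ennreal g" "0 \<le> g"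
    using mixture_finite[OF assms] by (cases "mixture j \<mu> a") auto
  obtain e where e: "energy j \<mu> = ennreal e" "0 \<le> e"
    using assms(1) by (cases "energy j \<mu>") auto
  have "a * g\<^sup>2 \<le> e"
    using mixture_square_le_energy[OF assms(2), of j \<mu>] assms(2) g e
    by (simp add: ennreal_mult[symmetric] ennreal_power)
  then have "g\<^sup>2 \<le> e / a"
    using assms(2) by (simp add: field_simps)
  then show ?thesis
    using g e by (simp add: real_le_rsqrt)
qed

text \<open>The inner integral of the kernel is finite only almost everywhere, but its Bochner value \<open>0\<close> on the
  exceptional null set does not change the outer integral.\<close>

lemma ls_criterion_eq:
  assumes k: "k \<ge> 2" and \<mu>: "\<mu> \<in> mixing_measures k" and x: "\<And>i. i \<in> {1..n} \<Longrightarrow> 0 < x i"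
  shows "ls_criterion n k x \<mu> =
    1 / 2 * enn2real (energy (k - 1) \<mu>) - 1 / real n * (\<Sum>i=1..n. enn2real (mixture (k - 1) \<mu> (x i)))"
proof -
  let ?j = "k - 1"
  have h: "halfline_measure \<mu>" and fin: "energy ?j \<mu> < \<infinity>"
    using \<mu> mixing_measures_iff[OF k] by auto
  interpret S: sigma_finite_measure \<mu> by (rule sigma_finite_halfline) fact
  have [measurable]: "(\<lambda>t. t) \<in> borel_measurable \<mu>"
    by (rule measurable_on_halfline) (auto simp: sets_halfline[OF h])
  have r: "r_kernel k t t' = enn2real (\<integral>\<^sup>+x. indicator {0<..} x *
      (ennreal (trunc_pow ?j x t) * ennreal (trunc_pow ?j x t')) \<partial>lborel)" for t t'
  proof -
    have "0 \<le> r_kernel k t t'"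
      unfolding r_kernel_def set_lebesgue_integral_def
      by (intro integral_nonneg_AE) (auto split: split_indicator)
    then show ?thesis
      unfolding ennreal_r_kernel[OF k, symmetric] by simp
  qed
  have [measurable]: "(\<lambda>(t', t). r_kernel k t t') \<in> borel_measurable (\<mu> \<Otimes>\<^sub>M \<mu>)"
    unfolding r by measurable
  have r0: "0 \<le> r_kernel k t t'" for t t' unfolding r by simp
  have inner: "(\<integral>t. r_kernel k t t' \<partial>\<mu>) = enn2real (\<integral>\<^sup>+t. ennreal (r_kernel k t t') \<partial>\<mu>)"
    if "t' \<in> space \<mu>" for t'
    using that by (intro integral_eq_nn_integral) (auto simp: r0)
  have fin': "(\<integral>\<^sup>+ t'. (\<integral>\<^sup>+ t. ennreal (r_kernel k t t') \<partial>\<mu>) \<partial>\<mu>) < \<infinity>"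
    using fin energy_eq_double_integral[OF k h] by simp
  have "(\<integral>t'. (\<integral>t. r_kernel k t t' \<partial>\<mu>) \<partial>\<mu>) = (\<integral>t'. enn2real (\<integral>\<^sup>+t. ennreal (r_kernel k t t') \<partial>\<mu>) \<partial>\<mu>)"
    by (intro Bochner_Integration.integral_cong refl inner)
  also have "\<dots> = enn2real (\<integral>\<^sup>+t'. ennreal (enn2real (\<integral>\<^sup>+t. ennreal (r_kernel k t t') \<partial>\<mu>)) \<partial>\<mu>)"
    by (rule integral_eq_nn_integral) auto
  also have "(\<integral>\<^sup>+t'. ennreal (enn2real (\<integral>\<^sup>+t. ennreal (r_kernel k t t') \<partial>\<mu>)) \<partial>\<mu>) =
      (\<integral>\<^sup>+t'. (\<integral>\<^sup>+t. ennreal (r_kernel k t t') \<partial>\<mu>) \<partial>\<mu>)"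
  proof (rule nn_integral_cong_AE)
    have "AE t' in \<mu>. (\<integral>\<^sup>+t. ennreal (r_kernel k t t') \<partial>\<mu>) \<noteq> \<infinity>"
      by (rule nn_integral_PInf_AE) (use fin' in auto)
    then show "AE t' in \<mu>. ennreal (enn2real (\<integral>\<^sup>+t. ennreal (r_kernel k t t') \<partial>\<mu>)) =
        (\<integral>\<^sup>+t. ennreal (r_kernel k t t') \<partial>\<mu>)"
      by eventually_elim (simp add: less_top)
  qed
  also have "\<dots> = energy ?j \<mu>"
    by (rule energy_eq_double_integral[OF k h])
  finally have double: "(\<integral>t'. (\<integral>t. r_kernel k t t' \<partial>\<mu>) \<partial>\<mu>) = enn2real (energy ?j \<mu>)" .
  have int: "integrable \<mu> (\<lambda>t. trunc_pow ?j (x i) t)" if "i \<in> {1..n}" for i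
    using mixture_finite[OF fin x[OF that]]
    by (intro integrableI_nonneg) (auto simp: mixture_def)
  have "(\<integral>t. s_emp n k x t \<partial>\<mu>) = 1 / real n * (\<Sum>i=1..n. \<integral>t. trunc_pow ?j (x i) t \<partial>\<mu>)"
    using int k by (simp add: s_emp_def trunc_pow_eq_max)
  also have "(\<Sum>i=1..n. \<integral>t. trunc_pow ?j (x i) t \<partial>\<mu>) = (\<Sum>i=1..n. enn2real (mixture ?j \<mu> (x i)))"
    unfolding mixture_def by (intro sum.cong refl integral_eq_nn_integral) auto
  finally show ?thesis
    unfolding ls_criterion_def double by simp
qed

section \<open>A mixture determines its mixing measure\<close>

lemma power_diff_le:
  fixes a b :: real
  assumes "0 \<le> b" "b \<le> a"
  shows "a ^ Suc j - b ^ Suc j \<le> real (Suc j) * a ^ j * (a - b)"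
proof (induction j)
  case (Suc j)
  have "a ^ Suc (Suc j) - b ^ Suc (Suc j) = a * (a ^ Suc j - b ^ Suc j) + b ^ Suc j * (a - b)"
    by (simp add: algebra_simps)
  also have "\<dots> \<le> a * (real (Suc j) * a ^ j * (a - b)) + a ^ Suc j * (a - b)"
    using assms by (intro add_mono mult_left_mono[OF Suc] mult_right_mono power_mono) auto
  also have "\<dots> = real (Suc (Suc j)) * a ^ Suc j * (a - b)"
    by (simp add: algebra_simps)
  finally show ?case .
qed simp

text \<open>The bound is uniform in \<open>h\<close>, so it serves as the integrable majorant when the difference
  quotients of a mixture are taken under the integral.\<close>

lemma trunc_pow_quotient_bounds:
  assumes "0 < h"
  shows "0 \<le> (trunc_pow (Suc j) x t - trunc_pow (Suc j) (x + h) t) / h"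
    and "(trunc_pow (Suc j) x t - trunc_pow (Suc j) (x + h) t) / h \<le> real (Suc j) * trunc_pow j x t"
proof -
  show "0 \<le> (trunc_pow (Suc j) x t - trunc_pow (Suc j) (x + h) t) / h"
    using assms trunc_pow_antimono[of x "x + h" "Suc j" t] by simp
  show "(trunc_pow (Suc j) x t - trunc_pow (Suc j) (x + h) t) / h \<le> real (Suc j) * trunc_pow j x t"
  proof (cases "x < t")
    case True
    let ?a = "t - x" and ?b = "max (t - (x + h)) 0"
    have "trunc_pow (Suc j) x t - trunc_pow (Suc j) (x + h) t = ?a ^ Suc j - ?b ^ Suc j"
      using True by (simp add: trunc_pow_eq_max)
    also have "\<dots> \<le> real (Suc j) * ?a ^ j * (?a - ?b)"
      using True assms by (intro power_diff_le) auto
    also have "\<dots> \<le> real (Suc j) * ?a ^ j * h"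
      using True assms by (intro mult_left_mono) auto
    finally show ?thesis
      using True assms by (simp add: trunc_pow_def pos_divide_le_eq)
  qed (use assms in \<open>simp add: trunc_pow_def\<close>)
qed

lemma trunc_pow_quotient_tendsto:
  "(\<lambda>n. (trunc_pow (Suc j) x t - trunc_pow (Suc j) (x + 1 / real (Suc n)) t) / (1 / real (Suc n)))
    \<longlonglongrightarrow> real (Suc j) * trunc_pow j x t"
proof (cases "x < t")
  case True
  let ?h = "\<lambda>n. 1 / real (Suc n)"
  have h: "?h \<longlonglongrightarrow> 0"
    using LIMSEQ_inverse_real_of_nat by (simp only: inverse_eq_divide)
  have "((\<lambda>s. - ((t - s) ^ Suc j)) has_field_derivative real (Suc j) * (t - x) ^ j) (at x)"
    by (auto intro!: derivative_eq_intros simp del: power_Suc)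
  then have "((\<lambda>h. (- ((t - (x + h)) ^ Suc j) - - ((t - x) ^ Suc j)) / h) \<longlongrightarrow> real (Suc j) * (t - x) ^ j) (at 0)"
    by (simp add: DERIV_def)
  then have "(\<lambda>n. (- ((t - (x + ?h n)) ^ Suc j) - - ((t - x) ^ Suc j)) / ?h n) \<longlonglongrightarrow> real (Suc j) * (t - x) ^ j"
    by (rule filterlim_compose) (use h in \<open>simp add: filterlim_at del: of_nat_Suc\<close>)
  moreover have "eventually (\<lambda>n. (- ((t - (x + ?h n)) ^ Suc j) - - ((t - x) ^ Suc j)) / ?h n =
      (trunc_pow (Suc j) x t - trunc_pow (Suc j) (x + ?h n) t) / ?h n) sequentially"
  proof -
    have "eventually (\<lambda>n. ?h n < t - x) sequentially"
      using order_tendstoD(2)[OF h] True by simp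
    then show ?thesis
    proof eventually_elim
      case (elim n)
      then have "x + ?h n < t" by linarith
      then show ?case
        using True unfolding trunc_pow_def by (simp del: power_Suc)
    qed
  qed
  ultimately show ?thesis
    using True by (auto simp: trunc_pow_def simp del: power_Suc elim: Lim_transform_eventually)
next
  case False
  moreover have "0 < 1 / real (Suc n)" for n by simp
  ultimately have "\<not> x + 1 / real (Suc n) < t" for n by (smt (verit))
  with False show ?thesis
    by (simp add: trunc_pow_def del: of_nat_Suc)
qed

text \<open>For \<open>t - x \<le> 1\<close> the lower power is at most \<open>1\<close>, otherwise it is at most the higher power; the mass
  of \<open>{x..}\<close> is finite.\<close>

lemma mixture_lower_power_finite:
  assumes \<mu>: "halfline_measure \<mu>" and fin: "mixture (Suc j) \<mu> x < \<infinity>" and x: "0 < x"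
  shows "mixture j \<mu> x < \<infinity>"
proof -
  have [measurable]: "(\<lambda>t. t) \<in> borel_measurable \<mu>"
    by (rule measurable_on_halfline) (auto simp: sets_halfline[OF \<mu>])
  have A: "{x..} \<in> sets \<mu>" by (rule atLeast_in_halfline[OF \<mu> x])
  have le: "trunc_pow j x t \<le> indicator {x..} t + trunc_pow (Suc j) x t" for t
  proof (cases "x < t")
    case True
    show ?thesis
    proof (cases "t - x \<le> 1")
      case True
      then have "(t - x) ^ j \<le> 1" using \<open>x < t\<close> by (intro power_le_one) auto
      then show ?thesis using \<open>x < t\<close> by (simp add: trunc_pow_def add_increasing2)
    next
      case False
      then have "(t - x) ^ j \<le> (t - x) ^ Suc j" by (intro power_increasing) auto
      then show ?thesis using \<open>x < t\<close> by (simp add: trunc_pow_def del: power_Suc)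
    qed
  qed (simp add: trunc_pow_def)
  have "mixture j \<mu> x \<le> (\<integral>\<^sup>+t. indicator {x..} t + ennreal (trunc_pow (Suc j) x t) \<partial>\<mu>)"
    unfolding mixture_def
  proof (rule nn_integral_mono)
    fix t
    have "ennreal (trunc_pow j x t) \<le> ennreal (indicator {x..} t + trunc_pow (Suc j) x t)"
      by (rule ennreal_leI[OF le])
    then show "ennreal (trunc_pow j x t) \<le> indicator {x..} t + ennreal (trunc_pow (Suc j) x t)"
      by (auto simp: ennreal_plus split: split_indicator)
  qed
  also have "\<dots> = emeasure \<mu> {x..} + mixture (Suc j) \<mu> x"
    using A by (simp add: nn_integral_add mixture_def)
  also have "\<dots> < \<infinity>"
    using emeasure_halfline_finite[OF \<mu> x] fin by simp
  finally show ?thesis .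
qed

lemma mixture_eq_integral:
  assumes \<mu>: "halfline_measure \<mu>" and fin: "mixture j \<mu> x < \<infinity>"
  shows "integrable \<mu> (trunc_pow j x)" and "mixture j \<mu> x = ennreal (\<integral>t. trunc_pow j x t \<partial>\<mu>)"
proof -
  have [measurable]: "(\<lambda>t. t) \<in> borel_measurable \<mu>"
    by (rule measurable_on_halfline) (auto simp: sets_halfline[OF \<mu>])
  show int: "integrable \<mu> (trunc_pow j x)"
    using fin by (intro integrableI_nonneg) (auto simp: mixture_def)
  show "mixture j \<mu> x = ennreal (\<integral>t. trunc_pow j x t \<partial>\<mu>)"
    unfolding mixture_def using int by (intro nn_integral_eq_integral) auto
qed

text \<open>Up to the sign, the mixture with exponent \<open>j\<close> is a multiple of the right derivative of the
  mixture with exponent \<open>j + 1\<close>. This also holds for \<open>j = 0\<close>, where a two-sided derivative fails to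
  exist at atoms of the measure.\<close>

lemma mixture_quotient_tendsto:
  assumes \<mu>: "halfline_measure \<mu>" and fin: "\<And>x. 0 < x \<Longrightarrow> mixture (Suc j) \<mu> x < \<infinity>" and x: "0 < x"
  shows "(\<lambda>n. (enn2real (mixture (Suc j) \<mu> x) - enn2real (mixture (Suc j) \<mu> (x + 1 / real (Suc n)))) /
      (1 / real (Suc n))) \<longlonglongrightarrow> real (Suc j) * enn2real (mixture j \<mu> x)"
proof -
  let ?h = "\<lambda>n. 1 / real (Suc n)"
  let ?q = "\<lambda>n t. (trunc_pow (Suc j) x t - trunc_pow (Suc j) (x + ?h n) t) / ?h n"
  have [measurable]: "(\<lambda>t. t) \<in> borel_measurable \<mu>"
    by (rule measurable_on_halfline) (auto simp: sets_halfline[OF \<mu>])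
  note int = mixture_eq_integral(1)[OF \<mu>] and mix = mixture_eq_integral(2)[OF \<mu>]
  have fin_j: "mixture j \<mu> x < \<infinity>"
    by (rule mixture_lower_power_finite[OF \<mu> fin[OF x] x])
  have xh: "0 < x + ?h n" for n
    using x by (simp add: add_pos_pos)
  have real_mix: "enn2real (mixture i \<mu> y) = (\<integral>t. trunc_pow i y t \<partial>\<mu>)" if "mixture i \<mu> y < \<infinity>" for i y
    using mix[OF that] by (simp add: integral_nonneg_AE)
  have "(\<lambda>n. \<integral>t. ?q n t \<partial>\<mu>) \<longlonglongrightarrow> (\<integral>t. real (Suc j) * trunc_pow j x t \<partial>\<mu>)"
  proof (rule integral_dominated_convergence)
    show "integrable \<mu> (\<lambda>t. real (Suc j) * trunc_pow j x t)"
      using int[OF fin_j] by simp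
    show "AE t in \<mu>. (\<lambda>n. ?q n t) \<longlonglongrightarrow> real (Suc j) * trunc_pow j x t"
      by (intro AE_I2 trunc_pow_quotient_tendsto)
    show "AE t in \<mu>. norm (?q n t) \<le> real (Suc j) * trunc_pow j x t" for n
      using trunc_pow_quotient_bounds[of "?h n" j x] by (intro AE_I2) simp
  qed measurable
  also have "(\<lambda>n. \<integral>t. ?q n t \<partial>\<mu>) =
      (\<lambda>n. (enn2real (mixture (Suc j) \<mu> x) - enn2real (mixture (Suc j) \<mu> (x + ?h n))) / ?h n)"
    using int[OF fin[OF x]] int[OF fin[OF xh]] by (simp add: real_mix[OF fin[OF x]] real_mix[OF fin[OF xh]] del: of_nat_Suc)
  finally show ?thesis
    using fin_j by (simp add: real_mix)
qed

lemma mixture_lower_power_eq: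
  assumes \<mu>: "halfline_measure \<mu>" and \<nu>: "halfline_measure \<nu>"
    and fin: "\<And>x. 0 < x \<Longrightarrow> mixture (Suc j) \<mu> x < \<infinity>"
    and eq: "\<And>x. 0 < x \<Longrightarrow> mixture (Suc j) \<mu> x = mixture (Suc j) \<nu> x"
    and x: "0 < x"
  shows "mixture j \<mu> x = mixture j \<nu> x"
proof -
  have fin': "\<And>x. 0 < x \<Longrightarrow> mixture (Suc j) \<nu> x < \<infinity>"
    using fin eq by metis
  have "0 < x + 1 / real (Suc n)" for n
    using x by (simp add: add_pos_pos)
  with eq x mixture_quotient_tendsto[OF \<mu> fin x] mixture_quotient_tendsto[OF \<nu> fin' x]
  have "real (Suc j) * enn2real (mixture j \<mu> x) = real (Suc j) * enn2real (mixture j \<nu> x)"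
    by (metis (no_types, lifting) LIMSEQ_unique ext)
  then have "enn2real (mixture j \<mu> x) = enn2real (mixture j \<nu> x)"
    by simp
  moreover have "mixture j \<mu> x < \<infinity>" "mixture j \<nu> x < \<infinity>"
    by (rule mixture_lower_power_finite[OF \<mu> fin[OF x] x], rule mixture_lower_power_finite[OF \<nu> fin'[OF x] x])
  ultimately show ?thesis
    by (cases "mixture j \<mu> x"; cases "mixture j \<nu> x") auto
qed

lemma greaterThan_eq_halfline:
  assumes "0 \<le> (x::real)"
  shows "{x<..} \<in> sets (restrict_space borel {0<..})"
  unfolding sets_restrict_space using assms by (auto intro!: image_eqI[of _ _ "{x<..}"])

lemma halfline_measure_eqI:
  assumes \<mu>: "halfline_measure \<mu>" and \<nu>: "halfline_measure \<nu>"
    and eq: "\<And>x. 0 < x \<Longrightarrow> emeasure \<mu> {x<..} = emeasure \<nu> {x<..}"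
  shows "\<mu> = \<nu>"
proof (rule measure_eqI_generator_eq)
  let ?E = "(\<inter>) {0::real<..} ` range greaterThan"
  have Ioi: "{0<..} \<inter> {x<..} = {max 0 x<..}" for x :: real
    by auto
  show "Int_stable ?E"
  proof (rule Int_stableI_image)
    fix A B :: "real set"
    show "\<exists>c\<in>range greaterThan. {0<..} \<inter> A \<inter> ({0<..} \<inter> B) = {0<..} \<inter> c"
      if "A \<in> range greaterThan" "B \<in> range greaterThan"
    proof -
      from that obtain a b where "A = {a<..}" "B = {b<..}" by auto
      then have "{0<..} \<inter> A \<inter> ({0<..} \<inter> B) = {0<..} \<inter> {max a b<..}" by auto
      then show ?thesis by blast
    qed
  qed
  have "sets (restrict_space borel {0::real<..}) = sigma_sets {0<..} ?E"
    unfolding borel_Ioi sets_restrict_space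
    using sigma_sets_Int[of "{0::real<..}" UNIV "range greaterThan"] by (simp add: sigma_sets.Basic)
  then show "sets \<mu> = sigma_sets {0<..} ?E" "sets \<nu> = sigma_sets {0<..} ?E"
    by (simp_all add: sets_halfline[OF \<mu>] sets_halfline[OF \<nu>])
  let ?A = "\<lambda>i. {1 / real (Suc i)<..}"
  have inc: "incseq ?A"
    by (intro incseq_SucI) (auto simp: frac_le intro: le_less_trans[rotated])
  have "\<exists>i. 1 / real (Suc i) < x" if "0 < x" for x
    using that by (metis inverse_eq_divide reals_Archimedean)
  then show UN: "(\<Union>i. ?A i) = {0<..}"
    by (force intro: less_trans[rotated])
  have pos: "0 < 1 / real (Suc i)" for i by simp
  \<comment> \<open>Intersecting with the half-line turns every \<open>{x<..}\<close> with \<open>x \<le> 0\<close> into \<open>{0<..}\<close>, whose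
    measure, possibly infinite, is the limit of those of the tails.\<close>
  have zero: "emeasure \<mu> {0<..} = emeasure \<nu> {0<..}"
  proof -
    have "emeasure P {0<..} = (SUP i. emeasure P (?A i))" if "halfline_measure P" for P
    proof -
      have "range ?A \<subseteq> sets P"
        using greaterThan_eq_halfline[OF less_imp_le[OF pos]] by (auto simp: sets_halfline[OF that])
      from SUP_emeasure_incseq[OF this inc] show ?thesis
        by (simp only: UN)
    qed
    with \<mu> \<nu> show ?thesis by (simp add: eq del: of_nat_Suc)
  qed
  show "emeasure \<mu> X = emeasure \<nu> X" if "X \<in> ?E" for X
  proof -
    from that obtain x where "X = {max 0 x<..}" by (auto simp: Ioi)
    then show ?thesis
      using zero eq[of x] by (cases "0 < x") (simp_all add: max_def)
  qed
  show "range ?A \<subseteq> ?E"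
    using Ioi pos by (fastforce simp: image_iff max_def)
  show "emeasure \<mu> (?A i) \<noteq> \<infinity>" for i
  proof -
    have "emeasure \<mu> (?A i) \<le> emeasure \<mu> {1 / real (Suc i)..}"
      by (intro emeasure_mono atLeast_in_halfline[OF \<mu>]) auto
    also have "\<dots> < \<infinity>"
      by (intro emeasure_halfline_finite[OF \<mu>]) simp
    finally show ?thesis by simp
  qed
qed auto

text \<open>Induction on the exponent by \<open>mixture_lower_power_eq\<close>; for exponent \<open>0\<close> the mixture is the tail of
  the measure.\<close>

theorem mixture_determines_measure:
  assumes \<mu>: "halfline_measure \<mu>" and \<nu>: "halfline_measure \<nu>"
    and fin: "\<And>x. 0 < x \<Longrightarrow> mixture j \<mu> x < \<infinity>"
    and eq: "\<And>x. 0 < x \<Longrightarrow> mixture j \<mu> x = mixture j \<nu> x"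
  shows "\<mu> = \<nu>"
  using fin eq
proof (induction j)
  case 0
  have "mixture 0 P x = emeasure P {x<..}" if "halfline_measure P" "0 < x" for P x
  proof -
    have "mixture 0 P x = (\<integral>\<^sup>+t. indicator {x<..} t \<partial>P)"
      unfolding mixture_def by (intro nn_integral_cong) (auto simp: trunc_pow_def split: split_indicator)
    then show ?thesis
      using that greaterThan_eq_halfline[of x] by (simp add: sets_halfline)
  qed
  with 0 \<mu> \<nu> show ?case
    by (intro halfline_measure_eqI) auto
next
  case (Suc j)
  show ?case
    using mixture_lower_power_finite[OF \<mu> Suc.prems(1)] mixture_lower_power_eq[OF \<mu> \<nu> Suc.prems]
    by (intro Suc.IH) auto
qed

section \<open>Compactness of mixtures of bounded energy\<close>

text \<open>The weight is of order \<open>t\<^sup>j\<^sup>+\<^sup>1\<close> at \<open>0\<close> and \<open>t\<^sup>j\<close> at infinity, like the integral of \<open>(t - x)\<^sub>+\<^sup>j\<close> over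
  \<open>0 < x \<le> 1\<close>, but in closed form.\<close>

definition weight :: "nat \<Rightarrow> real \<Rightarrow> real" where
  "weight j t = max t 0 ^ Suc j / (1 + max t 0)"

text \<open>The truncated power divided by the weight. Replacing \<open>t\<close> by \<open>max t x\<close> in the quotient changes
  nothing where the truncated power is nonzero, and makes the function continuous on the whole
  line.\<close>

definition weighted_kernel :: "nat \<Rightarrow> real \<Rightarrow> real \<Rightarrow> real" where
  "weighted_kernel j x t = max (t - x) 0 ^ j * (1 + max t x) / max t x ^ Suc j"

lemma weight_nonneg [simp]: "0 \<le> weight j t"
  by (simp add: weight_def)

lemma weight_measurable [measurable]: "weight j \<in> borel_measurable borel"
  unfolding weight_def by measurable

lemma weighted_kernel_nonneg: "0 < x \<Longrightarrow> 0 \<le> weighted_kernel j x t"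
  by (auto simp: weighted_kernel_def intro!: divide_nonneg_nonneg mult_nonneg_nonneg)

lemma weighted_kernel_le:
  assumes "0 < x"
  shows "weighted_kernel j x t \<le> 1 + 1 / x"
proof -
  let ?m = "max t x"
  have m: "0 < ?m" "x \<le> ?m" using assms by auto
  have "max (t - x) 0 ^ j \<le> ?m ^ j"
    using assms by (intro power_mono) auto
  then have "weighted_kernel j x t \<le> ?m ^ j * (1 + ?m) / ?m ^ Suc j"
    unfolding weighted_kernel_def using m
    by (intro divide_right_mono mult_right_mono) auto
  also have "\<dots> = 1 / ?m + 1"
    using m(1) by (simp add: field_simps)
  also have "\<dots> \<le> 1 + 1 / x"
    using m assms by (simp add: frac_le)
  finally show ?thesis .
qed

lemma weight_times_weighted_kernel:
  assumes "0 < x" "0 < j"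
  shows "weight j t * weighted_kernel j x t = trunc_pow j x t"
proof (cases "x < t")
  case True
  then have "0 < t" "0 < 1 + t" using assms by auto
  then show ?thesis
    using True by (simp add: weight_def weighted_kernel_def trunc_pow_def max_def)
qed (use assms in \<open>simp add: weighted_kernel_def trunc_pow_def\<close>)

lemma isCont_weighted_kernel:
  assumes "0 < x"
  shows "isCont (weighted_kernel j x) t"
  unfolding weighted_kernel_def using assms by (intro continuous_intros) auto

lemma weight_le_integral:
  "ennreal (weight j t) \<le> 2 ^ Suc j * (\<integral>\<^sup>+x. indicator {0<..1} x * ennreal (trunc_pow j x t) \<partial>lborel)"
proof (cases "0 < t")
  case True
  \<comment> \<open>On \<open>{0<..?m}\<close> the truncated power is at least \<open>(t / 2) ^ j\<close>, and the length of this interval is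
    at least half of \<open>t / (1 + t)\<close>.\<close>
  let ?m = "min t 1 / 2"
  have m: "0 < ?m" "?m \<le> 1" "?m \<le> t / 2" using True by auto
  have "t / (1 + t) \<le> min t 1"
    using True by (auto simp: min_def divide_le_eq algebra_simps)
  then have "weight j t \<le> t ^ j * min t 1"
    using True mult_left_mono[of "t / (1 + t)" "min t 1" "t ^ j"] by (simp add: weight_def mult.commute)
  also have "\<dots> = 2 ^ Suc j * ((t / 2) ^ j * ?m)"
    by (simp add: power_divide)
  finally have "ennreal (weight j t) \<le> ennreal (2 ^ Suc j * ((t / 2) ^ j * ?m))"
    by (rule ennreal_leI)
  also have "\<dots> = 2 ^ Suc j * (ennreal ((t / 2) ^ j) * ennreal ?m)"
  proof -
    have "ennreal (2 ^ Suc j) = 2 ^ Suc j"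
      by (subst ennreal_power[symmetric]) simp_all
    then show ?thesis
      using True m by (simp only: ennreal_mult zero_le_power mult_nonneg_nonneg zero_le_numeral
          less_imp_le divide_nonneg_pos zero_less_numeral)
  qed
  also have "ennreal ((t / 2) ^ j) * ennreal ?m = (\<integral>\<^sup>+x. ennreal ((t / 2) ^ j) * indicator {0<..?m} x \<partial>lborel)"
    using m by (subst nn_integral_cmult_indicator) auto
  also have "\<dots> \<le> (\<integral>\<^sup>+x. indicator {0<..1} x * ennreal (trunc_pow j x t) \<partial>lborel)"
  proof (rule nn_integral_mono)
    fix x
    have "(t / 2) ^ j \<le> trunc_pow j x t" if "x \<le> ?m"
    proof -
      have "t / 2 \<le> t - x" "x < t" using that m True by auto
      then show ?thesis using True by (simp add: trunc_pow_def power_mono)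
    qed
    then show "ennreal ((t / 2) ^ j) * indicator {0<..?m} x \<le> indicator {0<..1} x * ennreal (trunc_pow j x t)"
      using m(2) by (auto split: split_indicator intro!: ennreal_leI)
  qed
  finally show ?thesis
    by (simp add: mult_left_mono)
qed (simp add: weight_def)

text \<open>By Tonelli the weighted mass is controlled by the integral of the mixture over \<open>{0<..1}\<close>, and
  \<open>g \<le> 1 + g\<^sup>2\<close> there.\<close>

lemma nn_integral_weight_le:
  assumes \<mu>: "halfline_measure \<mu>"
  shows "(\<integral>\<^sup>+t. ennreal (weight j t) \<partial>\<mu>) \<le> 2 ^ Suc j * (1 + energy j \<mu>)"
proof -
  interpret S: sigma_finite_measure \<mu> by (rule sigma_finite_halfline) fact
  interpret P: pair_sigma_finite lborel \<mu> by unfold_locales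
  have [measurable]: "(\<lambda>t. t) \<in> borel_measurable \<mu>"
    by (rule measurable_on_halfline) (auto simp: sets_halfline[OF \<mu>])
  note [measurable] = mixture_measurable[OF \<mu>, of j]
  have square: "g \<le> 1 + g\<^sup>2" for g :: ennreal
  proof (cases g)
    case (real r)
    have "r \<le> 1 + r\<^sup>2"
      using zero_le_power2[of "r - 1 / 2"] by (simp add: power2_eq_square algebra_simps)
    then have "ennreal r \<le> ennreal (1 + r\<^sup>2)" by (rule ennreal_leI)
    then show ?thesis using real by (simp add: ennreal_power ennreal_plus)
  qed (simp add: power2_eq_square ennreal_top_mult)
  have "(\<integral>\<^sup>+t. ennreal (weight j t) \<partial>\<mu>) \<le>
      (\<integral>\<^sup>+t. 2 ^ Suc j * (\<integral>\<^sup>+x. indicator {0<..1} x * ennreal (trunc_pow j x t) \<partial>lborel) \<partial>\<mu>)"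
    by (intro nn_integral_mono weight_le_integral)
  also have "\<dots> = 2 ^ Suc j * (\<integral>\<^sup>+t. (\<integral>\<^sup>+x. indicator {0<..1} x * ennreal (trunc_pow j x t) \<partial>lborel) \<partial>\<mu>)"
    by (rule nn_integral_cmult) measurable
  also have "(\<integral>\<^sup>+t. (\<integral>\<^sup>+x. indicator {0<..1} x * ennreal (trunc_pow j x t) \<partial>lborel) \<partial>\<mu>) =
      (\<integral>\<^sup>+x. indicator {0<..1} x * mixture j \<mu> x \<partial>lborel)"
    by (subst P.Fubini') (simp_all add: nn_integral_cmult mixture_def)
  also have "\<dots> \<le> (\<integral>\<^sup>+x. indicator {0<..1} x + (mixture j \<mu> x)\<^sup>2 * indicator {0<..} x \<partial>lborel)"
    using square by (intro nn_integral_mono) (auto split: split_indicator)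
  also have "\<dots> = 1 + energy j \<mu>"
    by (simp add: nn_integral_add energy_def)
  finally show ?thesis
    by (simp add: mult_left_mono)
qed

text \<open>The missing mass is put at \<open>0\<close>, where functions with \<open>f 0 = 0\<close> do not see it. In this way all
  measures of a sequence are normalized by the same constant \<open>C\<close>, even if their weighted masses
  tend to \<open>0\<close>.\<close>

lemma weighted_completion:
  assumes \<mu>: "halfline_measure \<mu>" and C: "0 < C"
    and le: "(\<integral>\<^sup>+t. ennreal (weight j t) \<partial>\<mu>) \<le> ennreal C"
  obtains D where "real_distribution D"
    and "\<And>f. f \<in> borel_measurable borel \<Longrightarrow> f 0 = 0 \<Longrightarrow>
      (\<integral>\<^sup>+t. f t \<partial>D) = (\<integral>\<^sup>+t. ennreal (weight j t / C) * f t \<partial>\<mu>)"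
proof -
  have [measurable]: "(\<lambda>t. t) \<in> borel_measurable \<mu>"
    by (rule measurable_on_halfline) (auto simp: sets_halfline[OF \<mu>])
  define N where "N = density (distr \<mu> borel (\<lambda>t. t)) (\<lambda>t. ennreal (weight j t / C))"
  define D where "D = plus_measure N (scale_measure (1 - emeasure N UNIV) (return borel 0))"
  have N: "(\<integral>\<^sup>+t. f t \<partial>N) = (\<integral>\<^sup>+t. ennreal (weight j t / C) * f t \<partial>\<mu>)"
    if [measurable]: "f \<in> borel_measurable borel" for f
    unfolding N_def by (simp add: nn_integral_density nn_integral_distr)
  have [simp, measurable_cong]: "sets N = sets borel" and [simp]: "space N = UNIV"
    by (simp_all add: N_def)
  have "emeasure N UNIV = (\<integral>\<^sup>+t. indicator UNIV t \<partial>N)"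
    by (subst nn_integral_indicator) simp_all
  also have "\<dots> = (\<integral>\<^sup>+t. ennreal (1 / C) * ennreal (weight j t) \<partial>\<mu>)"
    using C by (subst N) (simp_all add: ennreal_mult[symmetric])
  also have "\<dots> = ennreal (1 / C) * (\<integral>\<^sup>+t. ennreal (weight j t) \<partial>\<mu>)"
    by (rule nn_integral_cmult) simp
  also have "\<dots> \<le> ennreal (1 / C) * ennreal C"
    using le by (intro mult_left_mono) auto
  also have "\<dots> = 1"
    using C by (simp add: ennreal_mult[symmetric])
  finally have mass: "emeasure N UNIV \<le> 1" .
  have "emeasure D UNIV = emeasure N UNIV + (1 - emeasure N UNIV)"
    unfolding D_def by (subst emeasure_plus_measure) simp_all
  also have "\<dots> = 1"
    using mass by (rule add_diff_inverse_ennreal)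
  finally have "real_distribution D"
    by (intro real_distribution.intro prob_spaceI real_distribution_axioms.intro) (simp_all add: D_def)
  moreover have "(\<integral>\<^sup>+t. f t \<partial>D) = (\<integral>\<^sup>+t. ennreal (weight j t / C) * f t \<partial>\<mu>)"
    if [measurable]: "f \<in> borel_measurable borel" and "f 0 = 0" for f
  proof -
    have "(\<integral>\<^sup>+t. f t \<partial>scale_measure (1 - emeasure N UNIV) (return borel 0)) = 0"
      using that by (subst nn_integral_scale_measure) (simp_all add: nn_integral_return)
    moreover have "f \<in> borel_measurable N"
      using that(1) measurable_cong_sets[OF \<open>sets N = sets borel\<close> refl] by blast
    ultimately show ?thesis
      unfolding D_def by (subst nn_integral_plus_measure) (simp_all add: N)
  qed
  ultimately show thesis
    by (rule that)
qed

lemma weight_le_trunc_pow: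
  assumes "0 < A" "A < t"
  shows "weight j t \<le> 2 ^ j * trunc_pow j (A / 2) t"
proof -
  have "t ^ j * (t / (1 + t)) \<le> t ^ j * 1"
    using assms by (intro mult_left_mono) auto
  then have "weight j t \<le> t ^ j"
    using assms by (simp add: weight_def mult.commute)
  also have "\<dots> \<le> (2 * (t - A / 2)) ^ j"
    using assms by (intro power_mono) auto
  also have "\<dots> = 2 ^ j * trunc_pow j (A / 2) t"
    using assms by (simp only: trunc_pow_def power_mult_distrib) auto
  finally show ?thesis .
qed

text \<open>Bounded energy bounds the weighted masses and, through the value of the mixture at \<open>A / 2\<close>, gives a
  uniform decay of the weighted tails beyond \<open>A\<close>. So the completed weighted measures are tight, and
  undoing the weight on the positive part of a weak limit gives the limiting mixing measure.\<close>

theorem mixture_compactness: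
  fixes \<mu> :: "nat \<Rightarrow> real measure"
  assumes j: "0 < j" and \<mu>: "\<And>m. halfline_measure (\<mu> m)"
    and energy: "\<And>m. energy j (\<mu> m) \<le> ennreal B" and B: "0 \<le> B"
  obtains r \<nu> where "strict_mono r" "halfline_measure \<nu>"
    "\<And>x. 0 < x \<Longrightarrow> (\<lambda>m. mixture j (\<mu> (r m)) x) \<longlonglongrightarrow> mixture j \<nu> x"
proof -
  define C where "C = 2 ^ Suc j * (1 + B)"
  have C: "0 < C" using B by (simp add: C_def)
  have "(\<integral>\<^sup>+t. ennreal (weight j t) \<partial>\<mu> m) \<le> ennreal C" for m
  proof -
    have "(\<integral>\<^sup>+t. ennreal (weight j t) \<partial>\<mu> m) \<le> 2 ^ Suc j * (1 + energy j (\<mu> m))"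
      by (rule nn_integral_weight_le[OF \<mu>])
    also have "\<dots> \<le> 2 ^ Suc j * (1 + ennreal B)"
      by (intro mult_left_mono add_left_mono energy) simp
    also have "\<dots> = ennreal C"
      using B by (simp add: C_def ennreal_mult ennreal_power[symmetric] del: power_Suc)
    finally show ?thesis .
  qed
  then have "\<exists>D. real_distribution D \<and> (\<forall>f\<in>borel_measurable borel. f 0 = 0 \<longrightarrow>
      (\<integral>\<^sup>+t. f t \<partial>D) = (\<integral>\<^sup>+t. ennreal (weight j t / C) * f t \<partial>\<mu> m))" for m
    using weighted_completion[OF \<mu> C] by metis
  then obtain D where D: "\<And>m. real_distribution (D m)"
    and D_int: "\<And>m f. f \<in> borel_measurable borel \<Longrightarrow> f 0 = 0 \<Longrightarrow>
      (\<integral>\<^sup>+t. f t \<partial>D m) = (\<integral>\<^sup>+t. ennreal (weight j t / C) * f t \<partial>\<mu> m)"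
    by metis
  have energy_fin: "energy j (\<mu> m) < \<infinity>" for m
    using energy[of m] by (rule le_less_trans) simp
  have id_meas [measurable]: "(\<lambda>t. t) \<in> borel_measurable (\<mu> m)" for m
    by (rule measurable_on_halfline) (auto simp: sets_halfline[OF \<mu>])
  have D_neg: "emeasure (D m) {..<0} = 0" for m
  proof -
    interpret D: real_distribution "D m" by (rule D)
    have "emeasure (D m) {..<0} = (\<integral>\<^sup>+t. indicator {..<0} t \<partial>D m)"
      by (subst nn_integral_indicator) simp_all
    also have "\<dots> = (\<integral>\<^sup>+t. ennreal (weight j t / C) * indicator {..<0} t \<partial>\<mu> m)"
      by (subst D_int) auto
    also have "\<dots> = (\<integral>\<^sup>+t. 0 \<partial>\<mu> m)"
      by (intro nn_integral_cong) (simp add: space_halfline[OF \<mu>])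
    finally show ?thesis by simp
  qed
  have D_tail: "measure (D m) {A<..} \<le> 2 ^ j / C * sqrt (2 * B / A)" if A: "0 < A" for m A
  proof -
    interpret D: real_distribution "D m" by (rule D)
    have fin: "mixture j (\<mu> m) (A / 2) < \<infinity>"
      using mixture_finite[OF energy_fin] A by simp
    have "emeasure (D m) {A<..} = (\<integral>\<^sup>+t. indicator {A<..} t \<partial>D m)"
      by (subst nn_integral_indicator) simp_all
    also have "\<dots> = (\<integral>\<^sup>+t. ennreal (weight j t / C) * indicator {A<..} t \<partial>\<mu> m)"
      using A by (subst D_int) auto
    also have "\<dots> \<le> (\<integral>\<^sup>+t. ennreal (2 ^ j / C) * ennreal (trunc_pow j (A / 2) t) \<partial>\<mu> m)"
      using weight_le_trunc_pow[OF A, of _ j] C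
      by (intro nn_integral_mono)
         (auto simp: ennreal_mult[symmetric] divide_right_mono split: split_indicator intro!: ennreal_leI)
    also have "\<dots> = ennreal (2 ^ j / C) * mixture j (\<mu> m) (A / 2)"
      by (simp add: nn_integral_cmult mixture_def)
    also have "\<dots> = ennreal (2 ^ j / C * enn2real (mixture j (\<mu> m) (A / 2)))"
      using fin C by (cases "mixture j (\<mu> m) (A / 2)") (simp_all add: ennreal_mult[symmetric])
    also have "\<dots> \<le> ennreal (2 ^ j / C * sqrt (2 * B / A))"
    proof (intro ennreal_leI mult_left_mono)
      have "enn2real (energy j (\<mu> m)) \<le> B"
        using energy[of m] B by (simp add: enn2real_leI)
      then have "sqrt (enn2real (energy j (\<mu> m)) / (A / 2)) \<le> sqrt (2 * B / A)"
        using A by (simp add: field_simps)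
      then show "enn2real (mixture j (\<mu> m) (A / 2)) \<le> sqrt (2 * B / A)"
        using A by (intro order_trans[OF mixture_le_sqrt_energy[OF energy_fin]]) simp_all
    qed (use C in simp)
    finally show ?thesis
      unfolding D.emeasure_eq_measure using A B C by (subst (asm) ennreal_le_iff) auto
  qed
  have "tight D"
    unfolding tight_def
  proof (intro conjI allI impI)
    fix \<epsilon> :: real assume \<epsilon>: "0 < \<epsilon>"
    \<comment> \<open>\<open>A\<close> is chosen to make the tail bound \<open>D_tail\<close> smaller than \<open>\<epsilon>\<close>.\<close>
    define \<delta> where "\<delta> = \<epsilon> * C / 2 ^ j"
    define A where "A = 2 * B / \<delta>\<^sup>2 + 1"
    have \<delta>: "0 < \<delta>" using \<epsilon> C by (simp add: \<delta>_def)
    have A: "0 < A" using B \<delta> by (simp add: A_def add_nonneg_pos)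
    have "2 * B / A < \<delta>\<^sup>2"
      using A \<delta> by (simp add: A_def field_simps)
    then have "sqrt (2 * B / A) < \<delta>"
      using \<delta> by (simp add: real_less_lsqrt)
    then have small: "2 ^ j / C * sqrt (2 * B / A) < \<epsilon>"
      using C by (simp add: \<delta>_def field_simps)
    have "1 - \<epsilon> < measure (D m) {-1<..A}" for m
    proof -
      interpret D: real_distribution "D m" by (rule D)
      have "1 = measure (D m) UNIV"
        using D.prob_space by simp
      also have "UNIV = {-1<..A} \<union> ({..<0} \<union> {A<..})"
        using A by auto
      also have "measure (D m) \<dots> \<le> measure (D m) {-1<..A} + (measure (D m) {..<0} + measure (D m) {A<..})"
        by (intro order_trans[OF measure_Un_le] add_left_mono measure_Un_le) auto
      also have "measure (D m) {..<0} = 0"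
        using D_neg by (simp add: measure_def)
      finally show ?thesis
        using D_tail[OF A, of m] small by simp
    qed
    then show "\<exists>a b. a < b \<and> (\<forall>m. 1 - \<epsilon> < measure (D m) {a<..b})"
      using A by (intro exI[of _ "-1"] exI[of _ A]) auto
  qed (rule D)
  then obtain r L where r: "strict_mono r" and L: "real_distribution L"
    and conv: "weak_conv_m (D \<circ> id \<circ> r) L"
    using tight_imp_convergent_subsubsequence[of D id] strict_mono_id by blast
  interpret L: real_distribution L by (rule L)
  let ?\<phi> = "weighted_kernel j"
  have \<phi>_meas [measurable]: "?\<phi> x \<in> borel_measurable borel" for x
    unfolding weighted_kernel_def by measurable
  have \<phi>_0: "?\<phi> x 0 = 0" if "0 < x" for x
    using that j by (simp add: weighted_kernel_def)
  have \<phi>_bound: "norm (?\<phi> x t) \<le> 1 + 1 / x" if "0 < x" for x t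
    using weighted_kernel_nonneg[OF that] weighted_kernel_le[OF that] by simp
  have \<phi>_int: "(\<integral>\<^sup>+t. ennreal (?\<phi> x t) \<partial>P) = ennreal (\<integral>t. ?\<phi> x t \<partial>P)"
    if "real_distribution P" "0 < x" for P x
  proof -
    interpret P: real_distribution P by fact
    have "integrable P (?\<phi> x)"
      using \<phi>_bound[OF \<open>0 < x\<close>] by (intro P.integrable_const_bound[of _ "1 + 1 / x"]) auto
    then show ?thesis
      using weighted_kernel_nonneg[OF \<open>0 < x\<close>] by (intro nn_integral_eq_integral) auto
  qed
  have mix_D: "mixture j (\<mu> m) x = ennreal (C * (\<integral>t. ?\<phi> x t \<partial>D m))" if x: "0 < x" for m x
  proof -
    have "mixture j (\<mu> m) x = (\<integral>\<^sup>+t. ennreal C * (ennreal (weight j t / C) * ennreal (?\<phi> x t)) \<partial>\<mu> m)"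
      unfolding mixture_def weight_times_weighted_kernel[OF x j, symmetric]
      using C weighted_kernel_nonneg[OF x] by (intro nn_integral_cong) (simp add: ennreal_mult[symmetric])
    also have "\<dots> = ennreal C * (\<integral>\<^sup>+t. ennreal (?\<phi> x t) \<partial>D m)"
      using \<phi>_0[OF x] by (simp add: nn_integral_cmult D_int)
    also have "\<dots> = ennreal (C * (\<integral>t. ?\<phi> x t \<partial>D m))"
      using C weighted_kernel_nonneg[OF x] by (simp add: \<phi>_int[OF D x] ennreal_mult integral_nonneg_AE)
    finally show ?thesis .
  qed
  \<comment> \<open>The density is the reciprocal of the weight. The limit may charge \<open>0\<close>; the restriction drops
    this atom, on which \<open>?\<phi> x\<close> vanishes.\<close>
  define \<nu> where "\<nu> = density (restrict_space L {0<..}) (\<lambda>t. ennreal (C * (1 + t) / t ^ Suc j))"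
  have sets_\<nu>: "sets \<nu> = sets (restrict_space borel {0<..})"
    by (simp add: \<nu>_def cong: sets_restrict_space_cong)
  have mix_\<nu>: "mixture j \<nu> x = ennreal (C * (\<integral>t. ?\<phi> x t \<partial>L))" if x: "0 < x" for x
  proof -
    have [measurable]: "(\<lambda>t. t) \<in> borel_measurable (restrict_space L {0<..})"
      by (intro measurable_restrict_space1) simp
    have "mixture j \<nu> x = (\<integral>\<^sup>+t. ennreal (C * (1 + t) / t ^ Suc j) * ennreal (trunc_pow j x t) * indicator {0<..} t \<partial>L)"
      unfolding mixture_def \<nu>_def
      by (simp add: nn_integral_density nn_integral_restrict_space)
    also have "\<dots> = (\<integral>\<^sup>+t. ennreal C * ennreal (?\<phi> x t) \<partial>L)"
    proof (rule nn_integral_cong)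
      fix t
      show "ennreal (C * (1 + t) / t ^ Suc j) * ennreal (trunc_pow j x t) * indicator {0<..} t =
          ennreal C * ennreal (?\<phi> x t)"
      proof (cases "x < t")
        case True
        then show ?thesis
          using x C by (simp add: ennreal_mult[symmetric] trunc_pow_def weighted_kernel_def max_def mult_ac)
      next
        case False
        then have "max (t - x) 0 = 0" by simp
        with j have "weighted_kernel j x t = 0"
          unfolding weighted_kernel_def by simp
        then show ?thesis
          using False by (simp add: trunc_pow_def)
      qed
    qed
    also have "\<dots> = ennreal (C * (\<integral>t. ?\<phi> x t \<partial>L))"
      using C weighted_kernel_nonneg[OF x]
      by (simp add: nn_integral_cmult \<phi>_int[OF L x] ennreal_mult integral_nonneg_AE)
    finally show ?thesis .
  qed
  have "emeasure \<nu> {a..} < \<infinity>" if a: "0 < a" for a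
  proof -
    have [measurable]: "(\<lambda>t. t) \<in> borel_measurable \<nu>"
      by (rule measurable_on_halfline) (auto simp: sets_\<nu>)
    have A: "{a..} \<in> sets \<nu>"
      unfolding sets_\<nu> sets_restrict_space using a by (auto intro!: image_eqI[of _ _ "{a..}"])
    have "ennreal ((a / 2) ^ j) * emeasure \<nu> {a..} = (\<integral>\<^sup>+t. ennreal ((a / 2) ^ j) * indicator {a..} t \<partial>\<nu>)"
      by (rule nn_integral_cmult_indicator[OF A, symmetric])
    also have "\<dots> \<le> mixture j \<nu> (a / 2)"
      unfolding mixture_def using a
      by (intro nn_integral_mono) (auto simp: trunc_pow_def split: split_indicator intro!: ennreal_leI power_mono)
    also have "\<dots> < \<infinity>"
      using mix_\<nu>[of "a / 2"] a by simp
    finally show ?thesis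
      using a by (cases "emeasure \<nu> {a..}") (auto simp: ennreal_mult_top)
  qed
  then have "halfline_measure \<nu>"
    using sets_\<nu> by (simp add: halfline_measure_def)
  moreover have "(\<lambda>m. mixture j (\<mu> (r m)) x) \<longlonglongrightarrow> mixture j \<nu> x" if x: "0 < x" for x
  proof -
    have "(\<lambda>m. \<integral>t. ?\<phi> x t \<partial>(D \<circ> id \<circ> r) m) \<longlonglongrightarrow> (\<integral>t. ?\<phi> x t \<partial>L)"
      by (rule weak_conv_imp_integral_bdd_continuous_conv[OF _ L conv])
         (use D isCont_weighted_kernel[OF x] \<phi>_bound[OF x] in auto)
    then show ?thesis
      unfolding mix_D[OF x] mix_\<nu>[OF x] by (intro tendsto_ennrealI tendsto_mult_left) simp
  qed
  ultimately show thesis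
    using r that by blast
qed

section \<open>Existence and uniqueness of the minimizer\<close>

text \<open>With \<open>e\<close> the square root of the energy and \<open>c\<close> the average of the \<open>1 / sqrt (x i)\<close>, the criterion is
  at least \<open>e\<^sup>2 / 2 - c e\<close>, and \<open>c e \<le> e\<^sup>2 / 4 + c\<^sup>2\<close>. The term \<open>e\<^sup>2 / 4\<close> that is kept bounds the energy along
  minimizing sequences.\<close>

lemma ls_criterion_ge:
  assumes k: "k \<ge> 2" and x: "\<And>i. i \<in> {1..n} \<Longrightarrow> 0 < x i" and \<mu>: "\<mu> \<in> mixing_measures k"
  shows "enn2real (energy (k - 1) \<mu>) / 4 - (1 / real n * (\<Sum>i=1..n. 1 / sqrt (x i)))\<^sup>2 \<le> ls_criterion n k x \<mu>"
proof -
  let ?c = "1 / real n * (\<Sum>i=1..n. 1 / sqrt (x i))"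
  define e where "e = sqrt (enn2real (energy (k - 1) \<mu>))"
  have e: "enn2real (energy (k - 1) \<mu>) = e\<^sup>2"
    by (simp add: e_def)
  have fin: "energy (k - 1) \<mu> < \<infinity>"
    using \<mu> mixing_measures_iff[OF k] by simp
  have "(\<Sum>i=1..n. enn2real (mixture (k - 1) \<mu> (x i))) \<le> (\<Sum>i=1..n. e * (1 / sqrt (x i)))"
    using mixture_le_sqrt_energy[OF fin x] by (intro sum_mono) (simp add: e_def real_sqrt_divide)
  then have "1 / real n * (\<Sum>i=1..n. enn2real (mixture (k - 1) \<mu> (x i))) \<le> 1 / real n * (\<Sum>i=1..n. e * (1 / sqrt (x i)))"
    by (intro mult_left_mono) simp_all
  also have "\<dots> = e * ?c"
    by (simp only: sum_distrib_left[symmetric] mult.left_commute)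
  finally have "e\<^sup>2 / 2 - e * ?c \<le> ls_criterion n k x \<mu>"
    by (subst ls_criterion_eq[OF k \<mu> x]) (simp_all only: e)
  moreover have "e\<^sup>2 / 4 - ?c\<^sup>2 \<le> e\<^sup>2 / 2 - e * ?c"
    using zero_le_power2[of "e / 2 - ?c"] by (simp add: power2_diff power_divide)
  ultimately show ?thesis
    unfolding e by linarith
qed

lemma null_measure_mixing: "null_measure (restrict_space borel {0<..}) \<in> mixing_measures k"
  by (simp add: mixing_measures_def)

text \<open>The direct method: pass to the limit in a minimizing sequence. The values at the sample points
  converge, so the energies converge too, and the energy of the limit is at most their limit by
  Fatou's lemma.\<close>

lemma ls_minimizer_exists:
  assumes k: "k \<ge> 2" and x: "\<And>i. i \<in> {1..n} \<Longrightarrow> 0 < x i"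
  shows "\<exists>\<mu>\<in>mixing_measures k. \<forall>\<nu>\<in>mixing_measures k. ls_criterion n k x \<mu> \<le> ls_criterion n k x \<nu>"
proof -
  let ?j = "k - 1" and ?ls = "ls_criterion n k x"
  define c where "c = (1 / real n * (\<Sum>i=1..n. 1 / sqrt (x i)))\<^sup>2"
  have c: "0 \<le> c" by (simp add: c_def)
  define m where "m = (INF \<mu>\<in>mixing_measures k. ?ls \<mu>)"
  have lower: "enn2real (energy ?j \<mu>) / 4 - c \<le> ?ls \<mu>" if "\<mu> \<in> mixing_measures k" for \<mu>
    unfolding c_def by (rule ls_criterion_ge[OF k x that])
  have "- c \<le> ?ls \<mu>" if "\<mu> \<in> mixing_measures k" for \<mu>
    using lower[OF that] by (smt (verit) enn2real_nonneg divide_nonneg_pos)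
  then have bdd: "bdd_below (?ls ` mixing_measures k)"
    by (auto simp: bdd_below_def)
  have m_le: "m \<le> ?ls \<mu>" if "\<mu> \<in> mixing_measures k" for \<mu>
    unfolding m_def using bdd that by (rule cINF_lower)
  have "\<exists>\<mu>\<in>mixing_measures k. ?ls \<mu> < m + 1 / real (Suc i)" for i
  proof (rule ccontr)
    assume "\<not> ?thesis"
    then have "m + 1 / real (Suc i) \<le> m"
      unfolding m_def using null_measure_mixing by (intro cINF_greatest) force+
    then show False by simp
  qed
  then obtain \<mu> where \<mu>: "\<And>i. \<mu> i \<in> mixing_measures k"
    and near: "\<And>i. ?ls (\<mu> i) < m + 1 / real (Suc i)"
    by metis
  have half: "halfline_measure (\<mu> i)" and fin: "energy ?j (\<mu> i) < \<infinity>" for i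
    using \<mu> mixing_measures_iff[OF k] by auto
  have "(\<lambda>i. m + 1 / real (Suc i)) \<longlonglongrightarrow> m + 0"
    using LIMSEQ_inverse_real_of_nat by (intro tendsto_add tendsto_const) (simp only: inverse_eq_divide)
  then have upper: "(\<lambda>i. m + 1 / real (Suc i)) \<longlonglongrightarrow> m"
    by (simp only: add_0_right)
  have ls_lim: "(\<lambda>i. ?ls (\<mu> i)) \<longlonglongrightarrow> m"
    by (rule tendsto_sandwich[OF _ _ tendsto_const upper])
       (intro always_eventually allI m_le[OF \<mu>] less_imp_le[OF near])+
  define B where "B = 4 * (\<bar>m\<bar> + 1 + c)"
  have B: "0 \<le> B" using c by (simp add: B_def)
  have "energy ?j (\<mu> i) \<le> ennreal B" for i
  proof -
    have "1 / real (Suc i) \<le> 1" by simp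
    then have "enn2real (energy ?j (\<mu> i)) \<le> B"
      using lower[OF \<mu>, of i] near[of i] unfolding B_def by argo
    then have "ennreal (enn2real (energy ?j (\<mu> i))) \<le> ennreal B"
      by (rule ennreal_leI)
    then show ?thesis using fin[of i] by simp
  qed
  then obtain r \<nu> where r: "strict_mono r" and \<nu>: "halfline_measure \<nu>"
    and conv: "\<And>y. 0 < y \<Longrightarrow> (\<lambda>i. mixture ?j (\<mu> (r i)) y) \<longlonglongrightarrow> mixture ?j \<nu> y"
    using mixture_compactness[of ?j \<mu> B] k half B by (metis One_nat_def Suc_1 Suc_le_eq zero_less_diff)
  define L where "L = (\<lambda>\<mu>. 1 / real n * (\<Sum>i=1..n. enn2real (mixture ?j \<mu> (x i))))"
  have ls_eq: "?ls \<mu> = 1 / 2 * enn2real (energy ?j \<mu>) - L \<mu>" if "\<mu> \<in> mixing_measures k" for \<mu>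
    unfolding L_def by (rule ls_criterion_eq[OF k that x])
  have \<nu>_fin: "mixture ?j \<nu> y \<noteq> \<infinity>" if y: "0 < y" for y
  proof -
    have "mixture ?j (\<mu> (r i)) y \<le> ennreal (sqrt (B / y))" for i
    proof -
      have "enn2real (energy ?j (\<mu> (r i))) \<le> B"
        using \<open>energy ?j (\<mu> (r i)) \<le> ennreal B\<close> B by (simp add: enn2real_leI)
      then have "enn2real (mixture ?j (\<mu> (r i)) y) \<le> sqrt (B / y)"
        using y by (intro order_trans[OF mixture_le_sqrt_energy[OF fin y]]) (simp add: divide_right_mono)
      then have "ennreal (enn2real (mixture ?j (\<mu> (r i)) y)) \<le> ennreal (sqrt (B / y))"
        by (rule ennreal_leI)
      then show ?thesis using mixture_finite[OF fin y] by simp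
    qed
    then have "mixture ?j \<nu> y \<le> ennreal (sqrt (B / y))"
      by (intro LIMSEQ_le_const2[OF conv[OF y]] exI allI impI)
    then show ?thesis by (auto simp: top_unique)
  qed
  have L_lim: "(\<lambda>i. L (\<mu> (r i))) \<longlonglongrightarrow> L \<nu>"
    unfolding L_def
  proof (intro tendsto_mult_left tendsto_sum)
    fix i assume "i \<in> {1..n}"
    then have "0 < x i" by (rule x)
    then have "(\<lambda>m. mixture ?j (\<mu> (r m)) (x i)) \<longlonglongrightarrow> ennreal (enn2real (mixture ?j \<nu> (x i)))"
      using conv \<nu>_fin by (simp add: less_top)
    then show "(\<lambda>m. enn2real (mixture ?j (\<mu> (r m)) (x i))) \<longlonglongrightarrow> enn2real (mixture ?j \<nu> (x i))"
      by (rule tendsto_enn2real) simp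
  qed
  \<comment> \<open>The energies converge because the criterion and its linear part do, so Fatou's lemma needs no
    further subsequence.\<close>
  have "(\<lambda>i. 2 * (?ls (\<mu> (r i)) + L (\<mu> (r i)))) \<longlonglongrightarrow> 2 * (m + L \<nu>)"
    using LIMSEQ_subseq_LIMSEQ[OF ls_lim r] L_lim by (intro tendsto_intros) (simp_all add: comp_def)
  also have "(\<lambda>i. 2 * (?ls (\<mu> (r i)) + L (\<mu> (r i)))) = (\<lambda>i. enn2real (energy ?j (\<mu> (r i))))"
    by (simp add: ls_eq[OF \<mu>])
  finally have energy_real: "(\<lambda>i. enn2real (energy ?j (\<mu> (r i)))) \<longlonglongrightarrow> 2 * (m + L \<nu>)" .
  then have energy_lim: "(\<lambda>i. energy ?j (\<mu> (r i))) \<longlonglongrightarrow> ennreal (2 * (m + L \<nu>))"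
    using tendsto_ennrealI[OF energy_real] by (simp only: ennreal_enn2real[OF fin[unfolded infinity_ennreal_def]])
  have nonneg: "0 \<le> 2 * (m + L \<nu>)"
    by (rule LIMSEQ_le_const[OF energy_real]) auto
  have "energy ?j \<nu> \<le> (\<integral>\<^sup>+y. liminf (\<lambda>i. (mixture ?j (\<mu> (r i)) y)\<^sup>2 * indicator {0<..} y) \<partial>lborel)"
    unfolding energy_def
  proof (rule nn_integral_mono)
    fix y :: real
    show "(mixture ?j \<nu> y)\<^sup>2 * indicator {0<..} y \<le> liminf (\<lambda>i. (mixture ?j (\<mu> (r i)) y)\<^sup>2 * indicator {0<..} y)"
    proof (cases "0 < y")
      case True
      have "(\<lambda>i. mixture ?j (\<mu> (r i)) y * mixture ?j (\<mu> (r i)) y) \<longlonglongrightarrow> mixture ?j \<nu> y * mixture ?j \<nu> y"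
        using \<nu>_fin[OF True] by (intro tendsto_mult_ennreal conv True) auto
      from lim_imp_Liminf[OF _ this] show ?thesis
        using True by (simp add: power2_eq_square)
    qed simp
  qed
  also have "\<dots> \<le> liminf (\<lambda>i. energy ?j (\<mu> (r i)))"
  proof -
    have [measurable]: "mixture ?j (\<mu> i) \<in> borel_measurable borel" for i
      by (rule mixture_measurable[OF half])
    show ?thesis
      unfolding energy_def by (intro nn_integral_liminf) measurable
  qed
  also have "\<dots> = ennreal (2 * (m + L \<nu>))"
    using energy_lim by (intro lim_imp_Liminf) auto
  finally have E: "energy ?j \<nu> \<le> ennreal (2 * (m + L \<nu>))" .
  then have \<nu>_mix: "\<nu> \<in> mixing_measures k"
    using \<nu> mixing_measures_iff[OF k] by (auto intro: le_less_trans)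
  have "enn2real (energy ?j \<nu>) \<le> 2 * (m + L \<nu>)"
    using E nonneg by (simp add: enn2real_leI)
  then have "?ls \<nu> \<le> m"
    by (simp add: ls_eq[OF \<nu>_mix])
  with \<nu>_mix m_le show ?thesis
    by (meson order_trans)
qed

lemma mixture_right_continuous:
  assumes \<mu>: "halfline_measure \<mu>" and fin: "mixture j \<mu> x < \<infinity>" and "0 < j"
  shows "(\<lambda>i. mixture j \<mu> (x + 1 / real (Suc i))) \<longlonglongrightarrow> mixture j \<mu> x"
proof -
  have [measurable]: "(\<lambda>t. t) \<in> borel_measurable \<mu>"
    by (rule measurable_on_halfline) (auto simp: sets_halfline[OF \<mu>])
  have h: "(\<lambda>i. 1 / real (Suc i)) \<longlonglongrightarrow> 0"
    using LIMSEQ_inverse_real_of_nat by (simp only: inverse_eq_divide)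
  show ?thesis
    unfolding mixture_def
  proof (rule nn_integral_dominated_convergence)
    show "(\<integral>\<^sup>+t. ennreal (trunc_pow j x t) \<partial>\<mu>) < \<infinity>"
      using fin by (simp add: mixture_def)
    show "AE t in \<mu>. ennreal (trunc_pow j (x + 1 / real (Suc i)) t) \<le> ennreal (trunc_pow j x t)" for i
      by (intro AE_I2 ennreal_leI trunc_pow_antimono) simp
    have "(\<lambda>i. max (t - (x + 1 / real (Suc i))) 0 ^ j) \<longlonglongrightarrow> max (t - (x + 0)) 0 ^ j" for t
      by (intro tendsto_intros h)
    then show "AE t in \<mu>. (\<lambda>i. ennreal (trunc_pow j (x + 1 / real (Suc i)) t)) \<longlonglongrightarrow> ennreal (trunc_pow j x t)"
      using \<open>0 < j\<close> by (intro AE_I2 tendsto_ennrealI) (simp add: trunc_pow_eq_max del: of_nat_Suc)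
  qed measurable
qed


text \<open>To the right of \<open>x\<close> there are points of equality arbitrarily close to \<open>x\<close>; monotonicity of both
  mixtures and right-continuity of the first one carry the inequality to \<open>x\<close>.\<close>

lemma mixture_le_of_AE_eq:
  assumes \<mu>: "halfline_measure \<mu>" and fin: "\<And>x. 0 < x \<Longrightarrow> mixture j \<mu> x < \<infinity>" and "0 < j"
    and AE: "AE x in lborel. 0 < x \<longrightarrow> mixture j \<mu> x = mixture j \<nu> x" and x: "0 < x"
  shows "mixture j \<mu> x \<le> mixture j \<nu> x"
proof (rule LIMSEQ_le_const2[OF mixture_right_continuous[OF \<mu> fin[OF x] \<open>0 < j\<close>]], intro exI allI impI)
  fix i :: nat
  let ?h = "1 / real (Suc i)"
  have "\<exists>y\<in>{x<..<x + ?h}. mixture j \<mu> y = mixture j \<nu> y"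
  proof (rule ccontr)
    assume "\<not> ?thesis"
    from AE have "AE y in lborel. y \<notin> {x<..<x + ?h}"
    proof eventually_elim
      case (elim y)
      then show ?case
        using x \<open>\<not> (\<exists>y\<in>{x<..<x + ?h}. mixture j \<mu> y = mixture j \<nu> y)\<close> by auto
    qed
    then have "{x<..<x + ?h} \<in> null_sets lborel"
      by (subst AE_iff_null_sets) simp_all
    then have "emeasure lborel {x<..<x + ?h} = 0"
      by (rule null_setsD1)
    then show False by simp
  qed
  then obtain y where y: "x < y" "y < x + ?h" "mixture j \<mu> y = mixture j \<nu> y" by auto
  have "mixture j \<mu> (x + ?h) \<le> mixture j \<mu> y"
    using y by (intro mixture_antimono) simp
  also have "\<dots> = mixture j \<nu> y" by fact
  also have "\<dots> \<le> mixture j \<nu> x"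
    using y by (intro mixture_antimono) simp
  finally show "mixture j \<mu> (x + ?h) \<le> mixture j \<nu> x" .
qed

lemma half_mult_ennreal: "0 \<le> a \<Longrightarrow> (1 / 2 :: ennreal) * ennreal a = ennreal (1 / 2 * a)"
  by (subst ennreal_mult) (simp_all add: divide_ennreal_def)

lemma enn2real_half: "enn2real (1 / 2) = 1 / 2"
  using half_mult_ennreal[of 1] enn2real_ennreal[of "1 / 2 * 1"]
  by (simp only: ennreal_1 mult_1_right)

lemma half_mult_finite: "a < \<infinity> \<Longrightarrow> (1 / 2 :: ennreal) * a < \<infinity>"
  by (cases a) (simp_all only: half_mult_ennreal, simp_all)

definition midpoint_measure :: "'a measure \<Rightarrow> 'a measure \<Rightarrow> 'a measure" where
  "midpoint_measure M N = scale_measure (1 / 2) (plus_measure M N)"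

lemma
  assumes \<mu>: "halfline_measure \<mu>" and \<nu>: "halfline_measure \<nu>"
  shows midpoint_halfline: "halfline_measure (midpoint_measure \<mu> \<nu>)"
    and mixture_midpoint: "mixture j (midpoint_measure \<mu> \<nu>) x = 1 / 2 * (mixture j \<mu> x + mixture j \<nu> x)"
proof -
  have s: "sets \<nu> = sets \<mu>"
    by (simp add: sets_halfline[OF \<mu>] sets_halfline[OF \<nu>])
  have [measurable]: "(\<lambda>t. t) \<in> borel_measurable \<mu>"
    by (rule measurable_on_halfline) (auto simp: sets_halfline[OF \<mu>])
  have "emeasure (midpoint_measure \<mu> \<nu>) {a..} < \<infinity>" if "0 < a" for a
    unfolding midpoint_measure_def emeasure_scale_measure
      emeasure_plus_measure[OF s atLeast_in_halfline[OF \<mu> that]]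
    using emeasure_halfline_finite[OF \<mu> that] emeasure_halfline_finite[OF \<nu> that]
    by (intro half_mult_finite) simp
  then show "halfline_measure (midpoint_measure \<mu> \<nu>)"
    by (simp add: halfline_measure_def midpoint_measure_def sets_halfline[OF \<mu>])
  have "trunc_pow j x \<in> borel_measurable \<mu>" by measurable
  then show "mixture j (midpoint_measure \<mu> \<nu>) x = 1 / 2 * (mixture j \<mu> x + mixture j \<nu> x)"
    unfolding mixture_def midpoint_measure_def
    by (simp add: nn_integral_scale_measure nn_integral_plus_measure[OF s])
qed

text \<open>The parallelogram identity in \<open>L\<^sup>2\<close>, written additively so that it makes sense in the extended
  nonnegative reals.\<close>

lemma energy_midpoint:
  assumes \<mu>: "halfline_measure \<mu>" and \<nu>: "halfline_measure \<nu>"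
    and fin: "energy j \<mu> < \<infinity>" "energy j \<nu> < \<infinity>"
  defines "g \<equiv> \<lambda>x. enn2real (mixture j \<mu> x)" and "h \<equiv> \<lambda>x. enn2real (mixture j \<nu> x)"
  shows "energy j (midpoint_measure \<mu> \<nu>) + (\<integral>\<^sup>+x\<in>{0<..}. ennreal (((g x - h x) / 2)\<^sup>2) \<partial>lborel) =
    1 / 2 * (energy j \<mu> + energy j \<nu>)"
proof -
  note meas [measurable] = mixture_measurable[OF \<mu>, of j] mixture_measurable[OF \<nu>, of j]
    mixture_measurable[OF midpoint_halfline[OF \<mu> \<nu>], of j]
  have [measurable]: "g \<in> borel_measurable borel" "h \<in> borel_measurable borel"
    unfolding g_def h_def by measurable
  have pointwise: "(mixture j (midpoint_measure \<mu> \<nu>) x)\<^sup>2 + ennreal (((g x - h x) / 2)\<^sup>2) =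
      1 / 2 * ((mixture j \<mu> x)\<^sup>2 + (mixture j \<nu> x)\<^sup>2)" if "0 < x" for x
  proof -
    have g: "mixture j \<mu> x = ennreal (g x)" and h: "mixture j \<nu> x = ennreal (h x)"
      and nonneg: "0 \<le> g x" "0 \<le> h x"
      using mixture_finite[OF fin(1) that] mixture_finite[OF fin(2) that] by (simp_all add: g_def h_def)
    have "((g x + h x) / 2)\<^sup>2 + ((g x - h x) / 2)\<^sup>2 = 1 / 2 * ((g x)\<^sup>2 + (h x)\<^sup>2)"
      by (simp add: power2_eq_square field_simps)
    then have "ennreal (((g x + h x) / 2)\<^sup>2 + ((g x - h x) / 2)\<^sup>2) = ennreal (1 / 2 * ((g x)\<^sup>2 + (h x)\<^sup>2))"
      by (rule arg_cong)
    then show ?thesis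
      using nonneg unfolding mixture_midpoint[OF \<mu> \<nu>] g h
      by (simp only: ennreal_plus[symmetric] half_mult_ennreal ennreal_power add_nonneg_nonneg
          zero_le_power2 mult_nonneg_nonneg) simp
  qed
  have "energy j (midpoint_measure \<mu> \<nu>) + (\<integral>\<^sup>+x\<in>{0<..}. ennreal (((g x - h x) / 2)\<^sup>2) \<partial>lborel) =
      (\<integral>\<^sup>+x\<in>{0<..}. ((mixture j (midpoint_measure \<mu> \<nu>) x)\<^sup>2 + ennreal (((g x - h x) / 2)\<^sup>2)) \<partial>lborel)"
    unfolding energy_def by (subst nn_integral_add[symmetric]) (simp_all add: distrib_right)
  also have "\<dots> = (\<integral>\<^sup>+x. 1 / 2 * ((mixture j \<mu> x)\<^sup>2 * indicator {0<..} x + (mixture j \<nu> x)\<^sup>2 * indicator {0<..} x) \<partial>lborel)"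
    by (intro nn_integral_cong) (simp add: pointwise split: split_indicator)
  also have "\<dots> = 1 / 2 * (energy j \<mu> + energy j \<nu>)"
    unfolding energy_def by (simp add: nn_integral_cmult nn_integral_add)
  finally show ?thesis .
qed

text \<open>The linear part of the criterion is the same average at the midpoint, so by the parallelogram
  identity the midpoint improves on two minimizers unless their mixtures agree almost
  everywhere.\<close>

lemma ls_minimizer_unique:
  assumes k: "k \<ge> 2" and x: "\<And>i. i \<in> {1..n} \<Longrightarrow> 0 < x i"
    and \<mu>: "\<mu> \<in> mixing_measures k" and \<nu>: "\<nu> \<in> mixing_measures k"
    and min_\<mu>: "\<And>\<kappa>. \<kappa> \<in> mixing_measures k \<Longrightarrow> ls_criterion n k x \<mu> \<le> ls_criterion n k x \<kappa>"
    and min_\<nu>: "\<And>\<kappa>. \<kappa> \<in> mixing_measures k \<Longrightarrow> ls_criterion n k x \<nu> \<le> ls_criterion n k x \<kappa>"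
  shows "\<mu> = \<nu>"
proof -
  let ?j = "k - 1" and ?ls = "ls_criterion n k x"
  have j: "0 < ?j" using k by simp
  have half: "halfline_measure \<mu>" "halfline_measure \<nu>"
    and fin: "energy ?j \<mu> < \<infinity>" "energy ?j \<nu> < \<infinity>"
    using \<mu> \<nu> mixing_measures_iff[OF k] by auto
  note mix_fin = mixture_finite[OF fin(1)] mixture_finite[OF fin(2)]
  define \<kappa> where "\<kappa> = midpoint_measure \<mu> \<nu>"
  define g where "g = (\<lambda>y. enn2real (mixture ?j \<mu> y))"
  define h where "h = (\<lambda>y. enn2real (mixture ?j \<nu> y))"
  define d where "d = (\<integral>\<^sup>+y\<in>{0<..}. ennreal (((g y - h y) / 2)\<^sup>2) \<partial>lborel)"
  have [measurable]: "g \<in> borel_measurable borel" "h \<in> borel_measurable borel"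
    unfolding g_def h_def
    using mixture_measurable[OF half(1), of ?j] mixture_measurable[OF half(2), of ?j] by measurable
  have sum: "energy ?j \<kappa> + d = 1 / 2 * (energy ?j \<mu> + energy ?j \<nu>)"
    unfolding \<kappa>_def d_def g_def h_def by (rule energy_midpoint[OF half fin])
  also have "\<dots> < \<infinity>"
    using fin by (intro half_mult_finite) simp
  finally have fin': "energy ?j \<kappa> < \<infinity>" "d < \<infinity>"
    by (simp_all add: less_top)
  obtain eK eD eM eN where e: "energy ?j \<kappa> = ennreal eK" "d = ennreal eD"
      "energy ?j \<mu> = ennreal eM" "energy ?j \<nu> = ennreal eN"
    and nonneg: "0 \<le> eK" "0 \<le> eD" "0 \<le> eM" "0 \<le> eN"
    using fin fin' by (auto simp: less_top_ennreal)
  have sum_real: "eK + eD = 1 / 2 * (eM + eN)"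
  proof -
    have "ennreal (eK + eD) = ennreal (1 / 2 * (eM + eN))"
      using sum nonneg unfolding e
      by (simp only: ennreal_plus[symmetric] half_mult_ennreal add_nonneg_nonneg)
    with nonneg show ?thesis
      by (subst (asm) ennreal_inj) simp_all
  qed
  have \<kappa>: "\<kappa> \<in> mixing_measures k"
    using fin'(1) midpoint_halfline[OF half] mixing_measures_iff[OF k] by (simp add: \<kappa>_def)
  define L where "L = (\<lambda>\<mu>. 1 / real n * (\<Sum>i=1..n. enn2real (mixture ?j \<mu> (x i))))"
  have ls_eq: "?ls \<mu> = 1 / 2 * enn2real (energy ?j \<mu>) - L \<mu>" if "\<mu> \<in> mixing_measures k" for \<mu>
    unfolding L_def by (rule ls_criterion_eq[OF k that x])
  have "enn2real (mixture ?j \<kappa> (x i)) = 1 / 2 * (enn2real (mixture ?j \<mu> (x i)) + enn2real (mixture ?j \<nu> (x i)))"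
    if "i \<in> {1..n}" for i
    unfolding \<kappa>_def mixture_midpoint[OF half] enn2real_mult enn2real_half
    using mix_fin[OF x[OF that]] by (simp add: enn2real_plus)
  then have "(\<Sum>i=1..n. enn2real (mixture ?j \<kappa> (x i))) =
      (\<Sum>i=1..n. 1 / 2 * (enn2real (mixture ?j \<mu> (x i)) + enn2real (mixture ?j \<nu> (x i))))"
    by (rule sum.cong[OF refl])
  also have "\<dots> = 1 / 2 * ((\<Sum>i=1..n. enn2real (mixture ?j \<mu> (x i))) + (\<Sum>i=1..n. enn2real (mixture ?j \<nu> (x i))))"
    by (simp only: sum.distrib sum_distrib_left[symmetric])
  finally have L: "L \<kappa> = 1 / 2 * (L \<mu> + L \<nu>)"
    unfolding L_def by (simp add: algebra_simps)
  have "eD \<le> 0"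
    using min_\<mu>[OF \<kappa>] min_\<nu>[OF \<kappa>] sum_real nonneg
    unfolding ls_eq[OF \<kappa>] ls_eq[OF \<mu>] ls_eq[OF \<nu>] L e
    by (simp only: enn2real_ennreal) argo
  then have "eD = 0"
    using nonneg by simp
  then have "AE y in lborel. ennreal (((g y - h y) / 2)\<^sup>2) * indicator {0<..} y = 0"
    using nn_integral_0_iff_AE[of "\<lambda>y. ennreal (((g y - h y) / 2)\<^sup>2) * indicator {0<..} y" lborel] e(2)
    by (simp add: d_def)
  then have AE: "AE y in lborel. 0 < y \<longrightarrow> mixture ?j \<mu> y = mixture ?j \<nu> y"
  proof eventually_elim
    case (elim y)
    show ?case
    proof
      assume y: "0 < y"
      with elim have "g y = h y" by simp
      then show "mixture ?j \<mu> y = mixture ?j \<nu> y"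
        using mix_fin[OF y] unfolding g_def h_def
        by (metis ennreal_enn2real infinity_ennreal_def)
    qed
  qed
  then have AE': "AE y in lborel. 0 < y \<longrightarrow> mixture ?j \<nu> y = mixture ?j \<mu> y"
    by eventually_elim simp
  show ?thesis
    using mixture_le_of_AE_eq[OF half(1) mix_fin(1) j AE] mixture_le_of_AE_eq[OF half(2) mix_fin(2) j AE']
    by (intro mixture_determines_measure[OF half mix_fin(1)] antisym)
qed

theorem proposition2p1:
  fixes k n :: nat
    and M :: "'a measure"
    and X :: "nat \<Rightarrow> 'a \<Rightarrow> real"
    and g\<^sub>0 :: "real \<Rightarrow> real"
  assumes "k \<ge> 2"
    and "n \<ge> 1"
    and "prob_space M"
    and "k_monotone k g\<^sub>0"
    and "\<And>i. i \<in> {1..n} \<Longrightarrow>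
           distributed M (restrict_space lborel {0<..}) (X i) (\<lambda>x. ennreal (g\<^sub>0 x))"
    and "prob_space.indep_vars M (\<lambda>_. restrict_space borel {0<..}) X {1..n}"
  shows "\<forall>\<omega>\<in>space M. \<exists>!\<mu>. \<mu> \<in> mixing_measures k \<and>
           (\<forall>\<nu>\<in>mixing_measures k.
              ls_criterion n k (\<lambda>i. X i \<omega>) \<mu> \<le> ls_criterion n k (\<lambda>i. X i \<omega>) \<nu>)"
proof
  fix \<omega> assume \<omega>: "\<omega> \<in> space M"
  have pos: "0 < X i \<omega>" if "i \<in> {1..n}" for i
    using measurable_space[OF distributed_measurable[OF assms(5)[OF that]] \<omega>]
    by (simp add: space_restrict_space)
  show "\<exists>!\<mu>. \<mu> \<in> mixing_measures k \<and>
      (\<forall>\<nu>\<in>mixing_measures k. ls_criterion n k (\<lambda>i. X i \<omega>) \<mu> \<le> ls_criterion n k (\<lambda>i. X i \<omega>) \<nu>)"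
    using ls_minimizer_exists[of k n "\<lambda>i. X i \<omega>", OF assms(1) pos]
      ls_minimizer_unique[of k n "\<lambda>i. X i \<omega>", OF assms(1) pos]
    by blast
qed

end
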